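(* Let $N,K\ge 1$ be integers and let $\mathcal{E}$ and $\mathcal{F}$ be arbitrary quantum operations (completely positive trace-preserving maps) acting on $\mathcal{M}_N$. Then for arbitrary bipartite quantum states $\rho,\sigma\in\mathcal{M}_{NK}$, $$d_{\mathrm{t}}\big[(\mathcal{E}\otimes\mathbb{1}_K)(\rho),(\mathcal{F}\otimes\mathbb{1}_K)(\sigma)\big]\;\le\; d_{\mathrm{t}}(\rho,\sigma)+d_{\mathrm{t}}^{K}(\mathcal{E},\mathcal{F}).$$
   Context: $\mathcal{M}_n$ denotes the set of density matrices (positive semidefinite, trace one) on an $n$-dimensional complex Hilbert space; $\mathcal{M}_{NK}$ is the set of density matrices on $\mathbb{C}^N\otimes\mathbb{C}^K$. $\mathbb{1}_K$ denotes the identity map on operators on $\mathbb{C}^K$. The von Neumann entropy is $\mathrm{S}(\rho)=-\mathrm{Tr}[\rho\log_2\rho]$ (with $0\log_2 0=0$). The quantum Jensen-Shannon divergence is $\mathrm{QJSD}(\rho,\sigma)=\mathrm{S}\big(\tfrac{\rho+\sigma}{2}\big)-\tfrac12\mathrm{S}(\rho)-\tfrac12\mathrm{S}(\sigma)$, and the transmission distance between states is $d_{\mathrm{t}}(\rho,\sigma)=\sqrt{\mathrm{QJSD}(\rho,\sigma)}$. For quantum operations $\mathcal{E},\mathcal{F}$ on $\mathcal{M}_N$ (extended linearly to all $N\times N$ matrices), the entropic channel divergence with ancilla of dimension $K$ is $$d_{\mathrm{t}}^{K}(\mathcal{E},\mathcal{F})=\sup_{\sigma\in\mathcal{M}_{NK}}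 d_{\mathrm{t}}[(\mathcal{E}\otimes\mathbb{1}_K)(\sigma),(\mathcal{F}\otimes\mathbb{1}_K)(\sigma)].$$ *)

theory Defs
  imports Complex_Main "Jordan_Normal_Form.Schur_Decomposition"
begin

definition mat_trace :: "'a::comm_monoid_add mat \<Rightarrow> 'a" where
  "mat_trace A = (\<Sum>i<dim_row A. A $$ (i, i))"

definition unitary_mat :: "nat \<Rightarrow> complex mat \<Rightarrow> bool" where
  "unitary_mat n U \<longleftrightarrow>
     U \<in> carrier_mat n n \<and> mat_adjoint U * U = 1\<^sub>m n \<and> U * mat_adjoint U = 1\<^sub>m n"

text \<open>The order on the complex numbers is the one of \<^theory>\<open>HOL-Library.Complex_Order\<close>:
  \<^term>\<open>0 \<le> (z::complex)\<close> says that \<^term>\<open>z\<close> is real and nonnegative.  Over the complex numbers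
  this forces the matrix to be Hermitian.\<close>

definition psd_mat :: "nat \<Rightarrow> complex mat \<Rightarrow> bool" where
  "psd_mat n A \<longleftrightarrow> A \<in> carrier_mat n n \<and> (\<forall>v \<in> carrier_vec n. 0 \<le> (A *\<^sub>v v) \<bullet>c v)"

definition density_mats :: "nat \<Rightarrow> complex mat set" where
  "density_mats n = {\<rho>. psd_mat n \<rho> \<and> mat_trace \<rho> = 1}"


text \<open>The functional calculus \<open>f(A) = U diag(f(d\<^sub>i)) U\<^sup>*\<close> of a Hermitian matrix
  \<open>A = U diag(d\<^sub>i) U\<^sup>*\<close>.  The lemma \<open>hermitian_fun_eq\<close> below shows that the result does not
  depend on the diagonalisation; for matrices that are not Hermitian the value is unspecified.\<close>

definition hermitian_fun :: "(real \<Rightarrow> real) \<Rightarrow> complex mat \<Rightarrow> complex mat" where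
  "hermitian_fun f A = (SOME B. \<exists>U d. unitary_mat (dim_row A) U \<and>
      A = U * mat_diag (dim_row A) (\<lambda>i. complex_of_real (d i)) * mat_adjoint U \<and>
      B = U * mat_diag (dim_row A) (\<lambda>i. complex_of_real (f (d i))) * mat_adjoint U)"

lemma mat_adjoint_carrier: "U \<in> carrier_mat n m \<Longrightarrow> mat_adjoint U \<in> carrier_mat m n"
  unfolding mat_adjoint_def by auto

lemma spectral_fun_unique:
  fixes d e :: "nat \<Rightarrow> real"
  assumes U: "unitary_mat n U" and V: "unitary_mat n V"
    and eq: "U * mat_diag n (\<lambda>i. complex_of_real (d i)) * mat_adjoint U =
             V * mat_diag n (\<lambda>i. complex_of_real (e i)) * mat_adjoint V"
  shows "U * mat_diag n (\<lambda>i. complex_of_real (f (d i))) * mat_adjoint U =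
         V * mat_diag n (\<lambda>i. complex_of_real (f (e i))) * mat_adjoint V"
proof -
  define U' V' W where "U' = mat_adjoint U" and "V' = mat_adjoint V" and "W = V' * U"
  define D where "D g = mat_diag n (\<lambda>i. complex_of_real (g i))" for g :: "nat \<Rightarrow> real"
  have carr: "U \<in> carrier_mat n n" "V \<in> carrier_mat n n" "U' \<in> carrier_mat n n"
    "V' \<in> carrier_mat n n" "W \<in> carrier_mat n n"
    using U V by (auto simp: unitary_mat_def U'_def V'_def W_def mat_adjoint_carrier
        intro!: mult_carrier_mat[of _ n n])
  have D: "D g \<in> carrier_mat n n" for g by (simp add: D_def)
  note mat_simps = assoc_mult_mat[of _ n n _ n _ n] mult_carrier_mat[of _ n n _ n]
    right_mult_one_mat[of _ n n] left_mult_one_mat[of _ n n]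
  have uni: "U' * U = 1\<^sub>m n" "U * U' = 1\<^sub>m n" "V' * V = 1\<^sub>m n" "V * V' = 1\<^sub>m n"
    using U V by (auto simp: unitary_mat_def U'_def V'_def)
  have eq': "U * D d * U' = V * D e * V'" using eq by (simp add: D_def U'_def V'_def)
  have "W * D d = V' * (U * D d * U') * U"
  proof -
    have "V' * (U * D d * U') * U = V' * (U * D d) * (U' * U)"
      using carr D by (simp add: mat_simps)
    also have "\<dots> = W * D d" using carr D uni
      by (simp add: W_def mat_simps)
    finally show ?thesis by simp
  qed
  also have "\<dots> = (V' * V) * D e * W"
    unfolding eq' W_def using carr D by (simp add: mat_simps)
  also have "\<dots> = D e * W" unfolding uni using carr D by (simp add: mat_simps)
  finally have WD: "W * D d = D e * W" .
  have entry: "W $$ (i, j) * d j = e i * W $$ (i, j)" if "i < n" "j < n" for i j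
  proof -
    have "(W * D d) $$ (i, j) = W $$ (i, j) * d j"
      unfolding D_def using that by (simp add: mat_diag_mult_right[OF carr(5)])
    moreover have "(D e * W) $$ (i, j) = e i * W $$ (i, j)"
      unfolding D_def using that by (simp add: mat_diag_mult_left[OF carr(5)])
    ultimately show ?thesis using WD by metis
  qed
  have entry': "W $$ (i, j) * f (d j) = f (e i) * W $$ (i, j)" if "i < n" "j < n" for i j
    using entry[OF that] by (cases "W $$ (i, j) = 0") (auto simp: mult.commute)
  have WD': "W * D (\<lambda>i. f (d i)) = D (\<lambda>i. f (e i)) * W"
    unfolding D_def using entry'
    by (intro eq_matI) (auto simp: mat_diag_mult_right[OF carr(5)] mat_diag_mult_left[OF carr(5)])
  have "U * D (\<lambda>i. f (d i)) * U' = (V * V') * U * D (\<lambda>i. f (d i)) * U'"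
    unfolding uni using carr D by (simp add: mat_simps)
  also have "\<dots> = V * (W * D (\<lambda>i. f (d i))) * U'"
    unfolding W_def using carr D by (simp add: mat_simps)
  also have "\<dots> = V * D (\<lambda>i. f (e i)) * V' * (U * U')"
    unfolding WD' unfolding W_def using carr D by (simp add: mat_simps)
  also have "\<dots> = V * D (\<lambda>i. f (e i)) * V'" unfolding uni using carr D by (simp add: mat_simps)
  finally show ?thesis by (simp add: D_def U'_def V'_def)
qed

lemma hermitian_fun_eq:
  fixes d :: "nat \<Rightarrow> real"
  assumes U: "unitary_mat n U"
    and A: "A = U * mat_diag n (\<lambda>i. complex_of_real (d i)) * mat_adjoint U"
  shows "hermitian_fun f A = U * mat_diag n (\<lambda>i. complex_of_real (f (d i))) * mat_adjoint U"
proof -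
  have n: "dim_row A = n" using U A by (auto simp: unitary_mat_def)
  show ?thesis
    unfolding hermitian_fun_def n
  proof (rule some_equality)
    fix B
    assume "\<exists>V e. unitary_mat n V \<and>
      A = V * mat_diag n (\<lambda>i. complex_of_real (e i)) * mat_adjoint V \<and>
      B = V * mat_diag n (\<lambda>i. complex_of_real (f (e i))) * mat_adjoint V"
    then show "B = U * mat_diag n (\<lambda>i. complex_of_real (f (d i))) * mat_adjoint U"
      using spectral_fun_unique[OF _ U] A by metis
  qed (use U A in blast)
qed


text \<open>Since \<^term>\<open>log 2 0 = 0\<close> in HOL, zero eigenvalues contribute \<open>0 log\<^sub>2 0 = 0\<close>.
  The trace is real on density matrices.\<close>

definition von_neumann_entropy :: "complex mat \<Rightarrow> real" where
  "von_neumann_entropy \<rho> = - Re (mat_trace (\<rho> * hermitian_fun (log 2) \<rho>))"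

definition QJSD :: "complex mat \<Rightarrow> complex mat \<Rightarrow> real" where
  "QJSD \<rho> \<sigma> = von_neumann_entropy ((1/2) \<cdot>\<^sub>m (\<rho> + \<sigma>))
     - 1/2 * von_neumann_entropy \<rho> - 1/2 * von_neumann_entropy \<sigma>"

definition transmission_dist :: "complex mat \<Rightarrow> complex mat \<Rightarrow> real" where
  "transmission_dist \<rho> \<sigma> = sqrt (QJSD \<rho> \<sigma>)"


text \<open>The tensor product of an \<open>N\<close>- and a \<open>K\<close>-dimensional space has dimension \<open>N * K\<close>, the
  basis vector \<open>e\<^sub>i \<otimes> e\<^sub>a\<close> having index \<open>i * K + a\<close>.  For a linear map \<open>\<E>\<close> on \<open>N \<times> N\<close>
  matrices, \<open>\<E> \<otimes> id\<^sub>K\<close> applies \<open>\<E>\<close> to each of the \<open>K\<^sup>2\<close> blocks \<open>(X\<^sub>i\<^sub>a\<^sub>,\<^sub>j\<^sub>b)\<^sub>i\<^sub>j\<close>; it is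
  characterised by the lemma \<open>tensor_id_kronecker\<close>.\<close>

definition kronecker :: "'a::times mat \<Rightarrow> 'a mat \<Rightarrow> 'a mat" where
  "kronecker A B = mat (dim_row A * dim_row B) (dim_col A * dim_col B)
     (\<lambda>(r, c). A $$ (r div dim_row B, c div dim_col B) * B $$ (r mod dim_row B, c mod dim_col B))"

definition tensor_id :: "nat \<Rightarrow> nat \<Rightarrow> (complex mat \<Rightarrow> complex mat) \<Rightarrow> complex mat \<Rightarrow> complex mat" where
  "tensor_id N K \<E> X = mat (N * K) (N * K)
     (\<lambda>(r, c). \<E> (mat N N (\<lambda>(i, j). X $$ (i * K + r mod K, j * K + c mod K))) $$ (r div K, c div K))"

definition linear_mat_map :: "nat \<Rightarrow> (complex mat \<Rightarrow> complex mat) \<Rightarrow> bool" where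
  "linear_mat_map N \<E> \<longleftrightarrow>
     (\<forall>A \<in> carrier_mat N N. \<E> A \<in> carrier_mat N N) \<and>
     (\<forall>A \<in> carrier_mat N N. \<forall>B \<in> carrier_mat N N. \<E> (A + B) = \<E> A + \<E> B) \<and>
     (\<forall>A \<in> carrier_mat N N. \<forall>c. \<E> (c \<cdot>\<^sub>m A) = c \<cdot>\<^sub>m \<E> A)"

definition completely_positive :: "nat \<Rightarrow> (complex mat \<Rightarrow> complex mat) \<Rightarrow> bool" where
  "completely_positive N \<E> \<longleftrightarrow> (\<forall>m X. psd_mat (N * m) X \<longrightarrow> psd_mat (N * m) (tensor_id N m \<E> X))"

definition trace_preserving :: "nat \<Rightarrow> (complex mat \<Rightarrow> complex mat) \<Rightarrow> bool" where
  "trace_preserving N \<E> \<longleftrightarrow> (\<forall>A \<in> carrier_mat N N. mat_trace (\<E> A) = mat_trace A)"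

definition quantum_operation :: "nat \<Rightarrow> (complex mat \<Rightarrow> complex mat) \<Rightarrow> bool" where
  "quantum_operation N \<E> \<longleftrightarrow>
     linear_mat_map N \<E> \<and> completely_positive N \<E> \<and> trace_preserving N \<E>"

lemma tensor_id_kronecker:
  assumes lin: "linear_mat_map N \<E>" and A: "A \<in> carrier_mat N N" and B: "B \<in> carrier_mat K K"
  shows "tensor_id N K \<E> (kronecker A B) = kronecker (\<E> A) B"
proof -
  have EA: "\<E> A \<in> carrier_mat N N" using lin A by (auto simp: linear_mat_map_def)
  have lt: "i * K + a < N * K" if "i < N" "a < K" for i a
  proof -
    have "i * K + a < Suc i * K" using that by simp
    also have "\<dots> \<le> N * K" using that by (intro mult_le_mono1) simp
    finally show ?thesis .
  qed
  have block: "mat N N (\<lambda>(i, j). kronecker A B $$ (i * K + a, j * K + b)) = B $$ (a, b) \<cdot>\<^sub>m A"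
    if "a < K" "b < K" for a b
    using A B that by (intro eq_matI) (auto simp: kronecker_def lt)
  show ?thesis
  proof (rule eq_matI)
    fix r c assume "r < dim_row (kronecker (\<E> A) B)" "c < dim_col (kronecker (\<E> A) B)"
    then have rc: "r < N * K" "c < N * K" using EA B by (auto simp: kronecker_def)
    then have "K > 0" by (cases K) auto
    then have m: "r mod K < K" "c mod K < K" by auto
    have d: "r div K < N" "c div K < N" using rc by (auto simp: less_mult_imp_div_less)
    have E: "\<E> (B $$ (r mod K, c mod K) \<cdot>\<^sub>m A) = B $$ (r mod K, c mod K) \<cdot>\<^sub>m \<E> A"
      using lin A by (auto simp: linear_mat_map_def)
    show "tensor_id N K \<E> (kronecker A B) $$ (r, c) = kronecker (\<E> A) B $$ (r, c)"
      using rc d EA B by (simp add: tensor_id_def block[OF m] E) (simp add: kronecker_def)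
  qed (use EA B in \<open>auto simp: tensor_id_def kronecker_def\<close>)
qed


text \<open>The supremum is over a nonempty set if \<open>N, K \<ge> 1\<close>, and bounded since the divergence
  of two density matrices lies in the unit interval.\<close>

definition channel_divergence ::
    "nat \<Rightarrow> nat \<Rightarrow> (complex mat \<Rightarrow> complex mat) \<Rightarrow> (complex mat \<Rightarrow> complex mat) \<Rightarrow> real" where
  "channel_divergence N K \<E> \<F> =
     (SUP \<sigma> \<in> density_mats (N * K). transmission_dist (tensor_id N K \<E> \<sigma>) (tensor_id N K \<F> \<sigma>))"

end

theory Submission
  imports Defs "HOL-Real_Asymp.Real_Asymp" "HOL-Computational_Algebra.Fundamental_Theorem_Algebra"
begin

text \<open>The triangle inequality for the transmission distance reduces the claim to
  \<open>QJSD (\<Phi> \<rho>) (\<Phi> \<sigma>) \<le> QJSD \<rho> \<sigma>\<close> for the quantum operation \<open>\<Phi> = \<E> \<otimes> id\<close>.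

  For the triangle inequality, \<open>QJSD\<close> is the integral over \<open>t > 0\<close> of the log-determinant
  divergence \<open>ln det ((A + B)/2) - (ln det A + ln det B)/2\<close> of the matrices shifted by \<open>t\<close> (up to
  the factor \<open>1 / ln 2\<close>).  A distance \<open>\<surd>q\<close> satisfies the triangle inequality as soon as
  \<open>q x y \<le> (1 + l) q x z + (1 + 1/l) q z y\<close> for all \<open>l > 0\<close>, and this form passes to
  integrals.  The log-determinant divergence is invariant under congruence, so \<open>x = 1\<close> without
  loss of generality; then the bound
  \<open>ln det (Z + D) \<ge> \<Sum> |\<langle>u\<^sub>i, v\<^sub>j\<rangle>|\<^sup>2 ln (z\<^sub>i + d\<^sub>j)\<close> in terms of the eigenvalues and
  eigenvectors of \<open>Z\<close> and \<open>D\<close> reduces everything to the scalar case, where the divergence is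
  \<open>ln cosh\<close> of half the difference of the logarithms.

  For the monotonicity, \<open>QJSD\<close> is a sum of two relative entropies to the mean, and the relative
  entropy is an integral over \<open>t > 0\<close> of the quasi-entropies
  \<open>sup\<^sub>Y 2 Re tr (Y\<^sup>* \<rho>) - tr (Y \<sigma> Y\<^sup>*) - t tr (Y\<^sup>* \<rho> Y)\<close>.  Each of these decreases
  under \<open>\<Phi>\<close> by the Cauchy-Schwarz inequality that complete positivity provides.\<close>


subsection \<open>Matrices, traces and diagonal forms\<close>

abbreviation adj :: "complex mat \<Rightarrow> complex mat" where "adj \<equiv> mat_adjoint"

lemma dim_adj [simp]: "dim_row (adj A) = dim_col A" "dim_col (adj A) = dim_row A"
  by (auto simp: mat_adjoint_def)

lemma index_adj [simp]: "i < dim_col A \<Longrightarrow> j < dim_row A \<Longrightarrow> adj A $$ (i, j) = cnj (A $$ (j, i))"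
  by (simp add: mat_adjoint_def mat_of_rows_index)

lemma adj_adj [simp]: "adj (adj A) = A"
  by (rule eq_matI) auto

lemma adj_mult:
  assumes "A \<in> carrier_mat n m" "B \<in> carrier_mat m k"
  shows "adj (A * B) = adj B * adj A"
  using assms by (intro eq_matI) (auto simp: scalar_prod_def mult.commute)

lemma adj_add:
  assumes "A \<in> carrier_mat n m" "B \<in> carrier_mat n m"
  shows "adj (A + B) = adj A + adj B"
  using assms by (intro eq_matI) auto

lemma adj_smult: "adj (c \<cdot>\<^sub>m A) = cnj c \<cdot>\<^sub>m adj A"
  by (intro eq_matI) auto

lemma mat_trace_mult:
  fixes A B :: "complex mat"
  assumes "A \<in> carrier_mat n m" "B \<in> carrier_mat m n"
  shows "mat_trace (A * B) = (\<Sum>i<n. \<Sum>j<m. A $$ (i, j) * B $$ (j, i))"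
  using assms by (auto simp: mat_trace_def scalar_prod_def atLeast0LessThan intro!: sum.cong)

lemma mat_trace_comm:
  fixes A B :: "complex mat"
  assumes A: "A \<in> carrier_mat n m" and B: "B \<in> carrier_mat m n"
  shows "mat_trace (A * B) = mat_trace (B * A)"
  unfolding mat_trace_mult[OF A B] mat_trace_mult[OF B A]
  by (subst sum.swap) (simp add: mult.commute)

lemma mat_trace_add:
  fixes A B :: "complex mat"
  assumes "A \<in> carrier_mat n n" "B \<in> carrier_mat n n"
  shows "mat_trace (A + B) = mat_trace A + mat_trace B"
  using assms by (auto simp: mat_trace_def sum.distrib)

lemma mat_trace_smult:
  fixes A :: "complex mat"
  assumes "A \<in> carrier_mat n n"
  shows "mat_trace (c \<cdot>\<^sub>m A) = c * mat_trace A"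
  using assms by (auto simp: mat_trace_def sum_distrib_left)

lemma mat_trace_adj:
  assumes "A \<in> carrier_mat n n"
  shows "mat_trace (adj A) = cnj (mat_trace A)"
  using assms by (auto simp: mat_trace_def)

section \<open>Unitary matrices\<close>

lemma unitary_carrier: "unitary_mat n U \<Longrightarrow> U \<in> carrier_mat n n"
  and unitary_adj_carrier: "unitary_mat n U \<Longrightarrow> adj U \<in> carrier_mat n n"
  by (auto simp: unitary_mat_def mat_adjoint_carrier)

lemma unitary_cancel:
  assumes "unitary_mat n U" "X \<in> carrier_mat n m"
  shows "adj U * (U * X) = X" "U * (adj U * X) = X"
proof -
  have "adj U * (U * X) = (adj U * U) * X" "U * (adj U * X) = (U * adj U) * X"
    using assms unitary_carrier[OF assms(1)] unitary_adj_carrier[OF assms(1)]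
    by (auto intro!: assoc_mult_mat[symmetric])
  then show "adj U * (U * X) = X" "U * (adj U * X) = X"
    using assms by (auto simp: unitary_mat_def)
qed

lemma unitary_one: "unitary_mat n (1\<^sub>m n)"
proof -
  have "adj (1\<^sub>m n) = 1\<^sub>m n" by (rule eq_matI) auto
  then show ?thesis by (simp add: unitary_mat_def)
qed

lemma unitary_adj: "unitary_mat n U \<Longrightarrow> unitary_mat n (adj U)"
  by (auto simp: unitary_mat_def mat_adjoint_carrier)

lemma unitary_mult:
  assumes U: "unitary_mat n U" and V: "unitary_mat n V"
  shows "unitary_mat n (U * V)"
proof -
  note c = unitary_carrier[OF U] unitary_adj_carrier[OF U] unitary_carrier[OF V] unitary_adj_carrier[OF V]
  have "adj (U * V) * (U * V) = adj V * (adj U * (U * V))"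
    using c by (simp add: adj_mult[of _ n n _ n] assoc_mult_mat[of _ n n _ n _ n])
  also have "\<dots> = 1\<^sub>m n" using c V unfolding unitary_cancel[OF U c(3)] by (simp add: unitary_mat_def)
  finally have 1: "adj (U * V) * (U * V) = 1\<^sub>m n" .
  have "(U * V) * adj (U * V) = U * (V * (adj V * adj U))"
    using c by (simp add: adj_mult[of _ n n _ n] assoc_mult_mat[of _ n n _ n _ n])
  also have "\<dots> = 1\<^sub>m n" using c U unfolding unitary_cancel[OF V c(2)] by (simp add: unitary_mat_def)
  finally show ?thesis using 1 c by (simp add: unitary_mat_def)
qed

lemma unitary_col_sum:
  assumes U: "unitary_mat n U" and j: "j < n"
  shows "(\<Sum>i<n. (cmod (U $$ (i, j)))\<^sup>2) = 1"
proof -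
  note c = unitary_carrier[OF U] unitary_adj_carrier[OF U]
  have "(1::complex) = (adj U * U) $$ (j, j)" using U j by (simp add: unitary_mat_def)
  also have "\<dots> = (\<Sum>i<n. cnj (U $$ (i, j)) * U $$ (i, j))"
    using c j by (auto simp: scalar_prod_def atLeast0LessThan)
  also have "\<dots> = of_real (\<Sum>i<n. (cmod (U $$ (i, j)))\<^sup>2)"
    by (simp add: complex_norm_square mult.commute del: of_real_power)
  finally show ?thesis by (metis of_real_eq_iff of_real_1)
qed

lemma unitary_row_sum:
  assumes U: "unitary_mat n U" and i: "i < n"
  shows "(\<Sum>j<n. (cmod (U $$ (i, j)))\<^sup>2) = 1"
  using unitary_col_sum[OF unitary_adj[OF U] i] i unitary_carrier[OF U] by simp


section \<open>Matrices in diagonal form and functions of their eigenvalues\<close>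

definition spec :: "nat \<Rightarrow> complex mat \<Rightarrow> (nat \<Rightarrow> real) \<Rightarrow> complex mat" where
  "spec n U f = U * mat_diag n (\<lambda>i. complex_of_real (f i)) * adj U"

lemma mat_diag_index: "i < n \<Longrightarrow> j < n \<Longrightarrow> mat_diag n f $$ (i, j) = (if i = j then f i else 0)"
  by (auto simp: mat_diag_def)

lemma spec_carrier [simp]: "unitary_mat n U \<Longrightarrow> spec n U f \<in> carrier_mat n n"
  by (auto simp: spec_def unitary_carrier unitary_adj_carrier intro!: mult_carrier_mat[of _ n n])

lemma spec_index:
  assumes "unitary_mat n U" "i < n" "j < n"
  shows "spec n U f $$ (i, j) = (\<Sum>k<n. of_real (f k) * U $$ (i, k) * cnj (U $$ (j, k)))"
  using assms unitary_carrier[OF assms(1)]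
  by (auto simp: spec_def mat_diag_mult_right[of _ n n] scalar_prod_def atLeast0LessThan intro!: sum.cong)

lemma spec_cong: "(\<And>i. i < n \<Longrightarrow> f i = g i) \<Longrightarrow> spec n U f = spec n U g"
proof -
  assume "\<And>i. i < n \<Longrightarrow> f i = g i"
  then have "mat_diag n (\<lambda>i. complex_of_real (f i)) = mat_diag n (\<lambda>i. complex_of_real (g i))"
    by (intro eq_matI) (auto simp: mat_diag_def)
  then show ?thesis by (simp add: spec_def)
qed

lemma spec_add: 
  assumes "unitary_mat n U" 
  shows "spec n U f + spec n U g = spec n U (\<lambda>i. f i + g i)"
  by (rule eq_matI) (use assms spec_carrier[OF assms] in \<open>auto simp: spec_index sum.distrib algebra_simps carrier_matD[OF spec_carrier[OF assms]]\<close>)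

lemma spec_smult: 
  assumes "unitary_mat n U" 
  shows "of_real c \<cdot>\<^sub>m spec n U f = spec n U (\<lambda>i. c * f i)"
  by (rule eq_matI) (use assms spec_carrier[OF assms] in \<open>auto simp: spec_index sum_distrib_left algebra_simps carrier_matD[OF spec_carrier[OF assms]]\<close>)

lemma spec_one: "unitary_mat n U \<Longrightarrow> spec n U (\<lambda>i. 1) = 1\<^sub>m n"
  by (auto simp: spec_def unitary_mat_def)

lemma spec_mult:
  assumes U: "unitary_mat n U"
  shows "spec n U f * spec n U g = spec n U (\<lambda>i. f i * g i)"
proof -
  note c = unitary_carrier[OF U] unitary_adj_carrier[OF U]
  define D where "D h = mat_diag n (\<lambda>i. complex_of_real (h i))" for h
  have D: "D h \<in> carrier_mat n n" for h by (simp add: D_def)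
  have "spec n U f * spec n U g = U * (D f * (adj U * (U * (D g * adj U))))"
    unfolding spec_def D_def[symmetric] using c D by (simp add: assoc_mult_mat[of _ n n _ n _ n] mult_carrier_mat[of _ n n])
  also have "\<dots> = U * (D f * D g) * adj U"
    using c D by (simp add: unitary_cancel[OF U, of _ n] assoc_mult_mat[of _ n n _ n _ n] mult_carrier_mat[of _ n n])
  finally show ?thesis by (simp add: D_def spec_def)
qed

lemma adj_spec:
  assumes "unitary_mat n U"
  shows "adj (spec n U f) = spec n U f"
  by (rule eq_matI) (use assms in \<open>auto simp: spec_index carrier_matD[OF spec_carrier[OF assms]] mult_ac intro!: sum.cong\<close>)

lemma mat_trace_spec:
  assumes U: "unitary_mat n U"
  shows "mat_trace (spec n U f) = of_real (\<Sum>i<n. f i)"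
proof -
  note c = unitary_carrier[OF U] unitary_adj_carrier[OF U]
  define D where "D = mat_diag n (\<lambda>i. complex_of_real (f i))"
  have D: "D \<in> carrier_mat n n" by (simp add: D_def)
  have "mat_trace (spec n U f) = mat_trace (adj U * (U * D))"
    unfolding spec_def D_def[symmetric] using c D by (intro mat_trace_comm[of _ n n]) auto
  then show ?thesis
    unfolding unitary_cancel[OF U D] by (simp add: D_def mat_trace_def mat_diag_def)
qed

lemma cmod_det_spec:
  assumes U: "unitary_mat n U"
  shows "cmod (det (spec n U f)) = (\<Prod>i<n. \<bar>f i\<bar>)"
proof -
  note c = unitary_carrier[OF U] unitary_adj_carrier[OF U]
  define D where "D = mat_diag n (\<lambda>i. complex_of_real (f i))"
  have D: "D \<in> carrier_mat n n" by (simp add: D_def)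
  have "det (U * adj U) = 1" using U by (simp add: unitary_mat_def)
  then have 1: "det U * det (adj U) = 1" using c by (simp add: det_mult[of _ n])
  have "det (spec n U f) = det U * det D * det (adj U)"
    unfolding spec_def D_def[symmetric] using c D by (simp add: det_mult[of _ n] mult_carrier_mat[of _ n n])
  also have "\<dots> = det D" using 1 by (simp add: algebra_simps)
  also have "det D = (\<Prod>i<n. of_real (f i))"
    using D by (subst det_upper_triangular[of _ n])
      (auto simp: D_def mat_diag_def diag_mat_def prod.list_conv_set_nth atLeast0LessThan)
  finally show ?thesis by (simp add: prod_norm[symmetric])
qed


subsection \<open>Positive semidefinite matrices and the spectral theorem\<close>

lemma mult_vec_cscalar_prod:
  assumes "A \<in> carrier_mat n m" "v \<in> carrier_vec m" "w \<in> carrier_vec n"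
  shows "(A *\<^sub>v v) \<bullet>c w = (\<Sum>i<n. \<Sum>j<m. A $$ (i, j) * v $ j * cnj (w $ i))"
  using assms by (auto simp: scalar_prod_def atLeast0LessThan sum_distrib_right intro!: sum.cong)

lemma psd_carrier: "psd_mat n A \<Longrightarrow> A \<in> carrier_mat n n"
  by (simp add: psd_mat_def)

lemma psd_form_nonneg:
  assumes "psd_mat n A"
  shows "0 \<le> (\<Sum>i<n. \<Sum>j<n. A $$ (i, j) * v j * cnj (v i))"
proof -
  have "0 \<le> (A *\<^sub>v vec n v) \<bullet>c vec n v" using assms by (simp add: psd_mat_def)
  also have "\<dots> = (\<Sum>i<n. \<Sum>j<n. A $$ (i, j) * v j * cnj (v i))"
    using assms by (subst mult_vec_cscalar_prod[of _ n n]) (auto simp: psd_mat_def)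
  finally show ?thesis .
qed

lemma psd_matI:
  assumes "A \<in> carrier_mat n n"
    and "\<And>v :: nat \<Rightarrow> complex. 0 \<le> (\<Sum>i<n. \<Sum>j<n. A $$ (i, j) * v j * cnj (v i))"
  shows "psd_mat n A"
  using assms by (auto simp: psd_mat_def mult_vec_cscalar_prod[of _ n n])

lemma sum_mult_delta:
  fixes f :: "nat \<Rightarrow> 'a::semiring_0"
  shows "i < n \<Longrightarrow> (\<Sum>l<n. f l * (if l = i then c else 0)) = f i * c"
  by (simp add: if_distrib[of "\<lambda>x. _ * x"] cong: if_cong)

lemma cnj_if: "cnj (if b then c else 0) = (if b then cnj c else 0)"
  by simp

text \<open>Polarisation: the form is real at every \<open>e_i + c e_j\<close>; the choices c = 1
  and c = i fix the imaginary and the real part of the difference between \<open>A $$ (i, j)\<close>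
  and the conjugate of \<open>A $$ (j, i)\<close>.\<close>

lemma psd_hermitian:
  assumes A: "psd_mat n A"
  shows "adj A = A"
proof -
  note c = psd_carrier[OF A]
  \<comment> \<open>This is the quadratic form at \<open>e_i + c e_j\<close>; the case i = j is
    included.\<close>
  have q: "A $$ (i, i) + c * A $$ (i, j) + cnj c * A $$ (j, i) + c * cnj c * A $$ (j, j) \<ge> 0"
    if ij: "i < n" "j < n" for i j c
  proof -
    have "(\<Sum>k<n. \<Sum>l<n. A $$ (k, l) * ((if l = i then 1 else 0) + (if l = j then c else 0)) *
            cnj ((if k = i then 1 else 0) + (if k = j then c else 0)))
      = (\<Sum>k<n. (A $$ (k, i) + A $$ (k, j) * c) *
            cnj ((if k = i then 1 else 0) + (if k = j then c else 0)))"
      using ij by (simp add: sum_distrib_right[symmetric] distrib_left sum.distrib sum_mult_delta)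
    also have "\<dots> = A $$ (i, i) + c * A $$ (i, j) + cnj c * A $$ (j, i) + c * cnj c * A $$ (j, j)"
      using ij by (simp add: distrib_left sum.distrib cnj_if sum_mult_delta) (simp add: algebra_simps)
    finally show ?thesis
      using psd_form_nonneg[OF A, of "\<lambda>k. (if k = i then 1 else 0) + (if k = j then c else 0)"] by simp
  qed
  have "cnj (A $$ (j, i)) = A $$ (i, j)" if ij: "i < n" "j < n" for i j
  proof -
    \<comment> \<open>The choice c = 0 leaves only a diagonal entry, which is therefore
      real.\<close>
    have "Im (A $$ (i, i)) = 0" "Im (A $$ (j, j)) = 0"
      using q[OF ij, of 0] q[OF ij(2,1), of 0] by (auto simp: less_eq_complex_def)
    then show ?thesis
      using q[OF ij, of 1] q[OF ij, of \<i>] by (auto simp: less_eq_complex_def complex_eq_iff)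
  qed
  then show ?thesis using c by (intro eq_matI) auto
qed

lemma cscalar_prod_adj:
  assumes M: "M \<in> carrier_mat n m" and x: "x \<in> carrier_vec m" and v: "v \<in> carrier_vec n"
  shows "(M *\<^sub>v x) \<bullet>c v = x \<bullet>c (adj M *\<^sub>v v)"
proof -
  have "(M *\<^sub>v x) \<bullet>c v = (\<Sum>j<m. \<Sum>i<n. M $$ (i, j) * x $ j * cnj (v $ i))"
    unfolding mult_vec_cscalar_prod[OF assms] by (rule sum.swap)
  also have "\<dots> = x \<bullet>c (adj M *\<^sub>v v)"
    using assms by (auto simp: scalar_prod_def atLeast0LessThan sum_distrib_left mult_ac intro!: sum.cong)
  finally show ?thesis .
qed

text \<open>\<open>M\<close> may be rectangular: the argument for complete positivity conjugates
  with a tall and with a wide block matrix.\<close>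

lemma psd_congruence:
  assumes A: "psd_mat m A" and M: "M \<in> carrier_mat n m"
  shows "psd_mat n (M * A * adj M)"
  unfolding psd_mat_def
proof (intro conjI ballI)
  note c = psd_carrier[OF A] M mat_adjoint_carrier[OF M]
  show "M * A * adj M \<in> carrier_mat n n"
    using c by (auto intro!: mult_carrier_mat[of _ n m])
  fix v :: "complex vec" assume v: "v \<in> carrier_vec n"
  have "(M * A * adj M) *\<^sub>v v = M *\<^sub>v (A *\<^sub>v (adj M *\<^sub>v v))"
    using c v by (simp add: assoc_mult_mat_vec[of _ n m _ n] assoc_mult_mat_vec[of _ n m _ m] mult_carrier_mat[of _ n m])
  then have "((M * A * adj M) *\<^sub>v v) \<bullet>c v = (A *\<^sub>v (adj M *\<^sub>v v)) \<bullet>c (adj M *\<^sub>v v)"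
    using c v by (simp add: cscalar_prod_adj[OF M] mult_mat_vec_carrier[of _ _ m])
  then show "0 \<le> ((M * A * adj M) *\<^sub>v v) \<bullet>c v"
    using A c v by (simp add: psd_mat_def)
qed

lemma psd_add:
  assumes A: "psd_mat n A" and B: "psd_mat n B"
  shows "psd_mat n (A + B)"
proof (rule psd_matI)
  note c = psd_carrier[OF A] psd_carrier[OF B]
  show "A + B \<in> carrier_mat n n" using c by simp
  fix v :: "nat \<Rightarrow> complex"
  have "(\<Sum>i<n. \<Sum>j<n. (A + B) $$ (i, j) * v j * cnj (v i)) =
    (\<Sum>i<n. \<Sum>j<n. A $$ (i, j) * v j * cnj (v i)) + (\<Sum>i<n. \<Sum>j<n. B $$ (i, j) * v j * cnj (v i))"
    using c by (simp add: sum.distrib distrib_right)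
  then show "0 \<le> (\<Sum>i<n. \<Sum>j<n. (A + B) $$ (i, j) * v j * cnj (v i))"
    using psd_form_nonneg[OF A] psd_form_nonneg[OF B] by simp
qed

lemma psd_smult:
  assumes A: "psd_mat n A" and x: "0 \<le> x"
  shows "psd_mat n (of_real x \<cdot>\<^sub>m A)"
proof (rule psd_matI)
  note c = psd_carrier[OF A]
  show "of_real x \<cdot>\<^sub>m A \<in> carrier_mat n n" using c by simp
  fix v :: "nat \<Rightarrow> complex"
  have "(\<Sum>i<n. \<Sum>j<n. (of_real x \<cdot>\<^sub>m A) $$ (i, j) * v j * cnj (v i)) =
    of_real x * (\<Sum>i<n. \<Sum>j<n. A $$ (i, j) * v j * cnj (v i))"
    using c by (simp add: sum_distrib_left mult_ac)
  then show "0 \<le> (\<Sum>i<n. \<Sum>j<n. (of_real x \<cdot>\<^sub>m A) $$ (i, j) * v j * cnj (v i))"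
    using psd_form_nonneg[OF A, of v] x by (simp add: less_eq_complex_def)
qed

lemma psd_diag_nonneg:
  assumes A: "psd_mat n A" and i: "i < n"
  shows "0 \<le> A $$ (i, i)"
proof -
  have "(\<Sum>k<n. \<Sum>l<n. A $$ (k, l) * (if l = i then 1 else 0) * cnj (if k = i then 1 else 0)) = A $$ (i, i)"
    using i by (simp add: cnj_if sum_distrib_right[symmetric] sum_mult_delta)
  then show ?thesis
    using psd_form_nonneg[OF A, of "\<lambda>k. if k = i then 1 else 0"] by simp
qed

lemma psd_trace_nonneg:
  assumes A: "psd_mat n A"
  shows "0 \<le> Re (mat_trace A)"
  using psd_diag_nonneg[OF A] psd_carrier[OF A]
  by (auto simp: mat_trace_def less_eq_complex_def intro!: sum_nonneg)

section \<open>Eigenvalues and the spectral theorem\<close>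

lemma spec_unitary_mult:
  assumes W: "unitary_mat n W" and V: "unitary_mat n V"
  shows "spec n (W * V) d = W * spec n V d * adj W"
proof -
  note c = unitary_carrier[OF W] unitary_adj_carrier[OF W] unitary_carrier[OF V] unitary_adj_carrier[OF V]
  define D where "D = mat_diag n (\<lambda>i. complex_of_real (d i))"
  have D: "D \<in> carrier_mat n n" by (simp add: D_def)
  show ?thesis unfolding spec_def D_def[symmetric] using c D
    by (simp add: adj_mult[of _ n n _ n] assoc_mult_mat[of _ n n _ n _ n] mult_carrier_mat[of _ n n])
qed

text \<open>Conjugation by the adjoint of \<open>U\<close> leaves the diagonal matrix of the
  \<open>d i\<close>, and diagonal entries of a positive semidefinite matrix are
  nonnegative.\<close>

lemma psd_spec_nonneg:
  assumes U: "unitary_mat n U" and A: "psd_mat n (spec n U d)" and i: "i < n"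
  shows "0 \<le> d i"
proof -
  note c = unitary_carrier[OF U] unitary_adj_carrier[OF U]
  have "adj U * spec n U d * U = spec n (adj U * U) d"
    using spec_unitary_mult[OF unitary_adj[OF U] U] by simp
  also have "\<dots> = spec n (1\<^sub>m n) d" using U by (simp add: unitary_mat_def)
  finally have "psd_mat n (spec n (1\<^sub>m n) d)"
    using psd_congruence[OF A c(2)] by simp
  from psd_diag_nonneg[OF this i] have "0 \<le> complex_of_real (d i)"
    using i by (simp add: spec_index[OF unitary_one] if_distrib[of cnj] if_distrib[of "\<lambda>x. _ * x"] cong: if_cong)
  then show ?thesis by (simp add: less_eq_complex_def)
qed

text \<open>Complete \<open>v\<close> to a basis, apply Gram-Schmidt, which keeps its first vector,
  and normalise the columns.\<close>

lemma exists_unitary_first_col: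
  assumes v: "v \<in> carrier_vec n" and v0: "v \<noteq> 0\<^sub>v n" and n: "n \<noteq> 0"
  obtains W c where "unitary_mat n W" and "col W 0 = c \<cdot>\<^sub>v v"
proof -
  interpret cof_vec_space n "TYPE(complex)" .
  define b where "b = basis_completion v"
  define ws where "ws = gram_schmidt n b"
  from basis_completion[OF v v0, folded b_def]
  have dist_b: "distinct b" and indep: "\<not> lin_dep (set b)" and b: "set b \<subseteq> carrier_vec n"
    and hdb: "hd b = v" and len_b: "length b = n" by auto
  from hdb len_b n obtain vs where bv: "b = v # vs" by (cases b) auto
  from gram_schmidt_result[OF b dist_b indep refl, folded ws_def]
  have ws: "set ws \<subseteq> carrier_vec n" "corthogonal ws" "length ws = n" by (auto simp: len_b)
  from gram_schmidt_hd[OF v, of vs, folded bv] have "hd ws = v" unfolding ws_def .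
  then have ws0: "ws ! 0 = v" using ws(3) n by (cases ws) auto
  have wsc: "ws ! j \<in> carrier_vec n" if "j < n" for j using ws that by auto
  define r where "r j = sqrt (Re ((ws ! j) \<bullet>c (ws ! j)))" for j
  have rr: "(ws ! j) \<bullet>c (ws ! j) = of_real (r j * r j)" "r j \<noteq> 0" if j: "j < n" for j
  proof -
    have "(ws ! j) \<bullet>c (ws ! j) \<noteq> 0" using corthogonalD[OF ws(2), of j j] j ws by auto
    moreover have "0 \<le> (ws ! j) \<bullet>c (ws ! j)" by (rule conjugate_square_ge_0_vec)
    ultimately show "(ws ! j) \<bullet>c (ws ! j) = of_real (r j * r j)" "r j \<noteq> 0"
      by (auto simp: r_def less_eq_complex_def complex_eq_iff)
  qed
  define W where "W = mat n n (\<lambda>(i, j). (ws ! j) $ i / of_real (r j))"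
  have W: "W \<in> carrier_mat n n" by (simp add: W_def)
  have "adj W * W = 1\<^sub>m n"
  proof (rule eq_matI)
    fix i j assume "i < dim_row (1\<^sub>m n)" "j < dim_col (1\<^sub>m n)"
    then have ij: "i < n" "j < n" by auto
    have "(adj W * W) $$ (i, j) = (\<Sum>k<n. (ws ! j) $ k * cnj ((ws ! i) $ k)) / of_real (r i * r j)"
      using ij by (auto simp: W_def scalar_prod_def atLeast0LessThan sum_divide_distrib mult_ac intro!: sum.cong)
    also have "(\<Sum>k<n. (ws ! j) $ k * cnj ((ws ! i) $ k)) = (ws ! j) \<bullet>c (ws ! i)"
      using wsc[OF ij(1)] wsc[OF ij(2)] by (auto simp: scalar_prod_def atLeast0LessThan)
    finally show "(adj W * W) $$ (i, j) = 1\<^sub>m n $$ (i, j)"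
      using rr[OF ij(1)] ij corthogonalD[OF ws(2), of j i] ws(3) by (cases "i = j") auto
  qed (simp_all add: W_def)
  moreover from this have "W * adj W = 1\<^sub>m n"
    using mat_mult_left_right_inverse[of "adj W" n W] W by (simp add: mat_adjoint_carrier)
  ultimately have "unitary_mat n W" using W by (simp add: unitary_mat_def)
  moreover have "col W 0 = (1 / of_real (r 0)) \<cdot>\<^sub>v v"
    using n v by (intro eq_vecI) (auto simp: W_def ws0)
  ultimately show thesis by (rule that)
qed

text \<open>Induction on the dimension. A unitary whose first column is an eigenvector brings
  \<open>A\<close> to the block form of an eigenvalue and a smaller Hermitian matrix, to which the
  induction hypothesis applies.\<close>

theorem spectral_theorem:
  assumes "A \<in> carrier_mat n n" "adj A = A"
  obtains U d where "unitary_mat n U" "A = spec n U d"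
proof -
  have "\<exists>U d. unitary_mat n U \<and> A = spec n U d"
    using assms
  proof (induction n arbitrary: A)
    case 0
    then have "unitary_mat 0 (1\<^sub>m 0)" "A = spec 0 (1\<^sub>m 0) (\<lambda>_. 0)"
      by (auto simp: unitary_one carrier_matD[OF spec_carrier[OF unitary_one]] intro!: eq_matI)
    then show ?case by blast
  next
    case (Suc m)
    note A = Suc.prems(1)
    let ?n = "Suc m"
    have "degree (char_poly A) = ?n" using degree_monic_char_poly[OF A] by simp
    then have "\<not> constant (poly (char_poly A))" by (simp add: constant_degree)
    then obtain e where "poly (char_poly A) e = 0" using fundamental_theorem_of_algebra by blast
    then have "eigenvalue A e" using eigenvalue_root_char_poly[OF A] by simp
    then obtain v where v: "v \<in> carrier_vec ?n" "v \<noteq> 0\<^sub>v ?n" and ev: "A *\<^sub>v v = e \<cdot>\<^sub>v v"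
      using A by (auto simp: eigenvalue_def eigenvector_def)
    obtain W c where W: "unitary_mat ?n W" and W0: "col W 0 = c \<cdot>\<^sub>v v"
      using exists_unitary_first_col[OF v] by blast
    note cW = unitary_carrier[OF W] unitary_adj_carrier[OF W]
    define B where "B = adj W * A * W"
    have cB: "B \<in> carrier_mat ?n ?n" using cW A by (simp add: B_def mult_carrier_mat[of _ ?n ?n])
    have hB: "adj B = B"
      unfolding B_def using cW A Suc.prems(2)
      by (simp add: adj_mult[of _ ?n ?n _ ?n] assoc_mult_mat[of _ ?n ?n _ ?n _ ?n] mult_carrier_mat[of _ ?n ?n])
    have "col (A * W) 0 = A *\<^sub>v (c \<cdot>\<^sub>v v)" using A cW W0 by (subst col_mult2[of _ ?n ?n]) auto
    also have "\<dots> = e \<cdot>\<^sub>v col W 0"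
      using A v ev W0 by (simp add: mult_mat_vec[of _ ?n ?n] smult_smult_assoc mult.commute)
    finally have col: "col (A * W) 0 = e \<cdot>\<^sub>v col W 0" .
    \<comment> \<open>The first column of \<open>B\<close> comes from the eigenvector equation; the
      first row then follows because \<open>B\<close> is Hermitian.\<close>
    have B0: "B $$ (i, 0) = (if i = 0 then e else 0)" if i: "i < ?n" for i
    proof -
      have "B $$ (i, 0) = row (adj W) i \<bullet> col (A * W) 0"
        using cW A i by (simp add: B_def assoc_mult_mat[of _ ?n ?n _ ?n _ ?n])
      also have "\<dots> = e * (row (adj W) i \<bullet> col W 0)"
        unfolding col using cW i by simp
      also have "row (adj W) i \<bullet> col W 0 = (adj W * W) $$ (i, 0)" using cW i by simp
      also have "\<dots> = (if i = 0 then 1 else 0)" using W i by (simp add: unitary_mat_def)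
      finally show ?thesis by simp
    qed
    have Bcnj: "B $$ (i, j) = cnj (B $$ (j, i))" if "i < ?n" "j < ?n" for i j
      using arg_cong[OF hB, of "\<lambda>X. X $$ (i, j)"] cB that by simp
    have e: "e = of_real (Re e)" using arg_cong[OF Bcnj[of 0 0], of Im] B0[of 0] by (simp add: complex_eq_iff)
    have B0': "B $$ (0, i) = (if i = 0 then e else 0)" if i: "i < ?n" for i
      using Bcnj[of 0 i] B0[of i] B0[of 0] i by (cases "i = 0") auto
    define A' where "A' = mat m m (\<lambda>(i, j). B $$ (Suc i, Suc j))"
    have "adj A' = A'" by (rule eq_matI) (auto simp: A'_def intro!: Bcnj[symmetric])
    then obtain U' d' where U': "unitary_mat m U'" and A': "A' = spec m U' d'"
      using Suc.IH[of A'] by (auto simp: A'_def)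
    note cU' = unitary_carrier[OF U']
    \<comment> \<open>\<open>V\<close> is the direct sum of 1 and \<open>U'\<close>, and
      \<open>d\<close> puts the eigenvalue \<open>e\<close> in front of \<open>d'\<close>.\<close>
    define V where "V = mat ?n ?n (\<lambda>(i, j). case i of 0 \<Rightarrow> (case j of 0 \<Rightarrow> 1 | Suc _ \<Rightarrow> 0)
      | Suc i' \<Rightarrow> (case j of 0 \<Rightarrow> 0 | Suc j' \<Rightarrow> U' $$ (i', j')))"
    define d where "d = case_nat (Re e) d'"
    have cV: "V \<in> carrier_mat ?n ?n" by (simp add: V_def)
    have Vi: "V $$ (0, 0) = 1" "\<And>i. i < m \<Longrightarrow> V $$ (Suc i, 0) = 0" "\<And>j. j < m \<Longrightarrow> V $$ (0, Suc j) = 0"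
      "\<And>i j. i < m \<Longrightarrow> j < m \<Longrightarrow> V $$ (Suc i, Suc j) = U' $$ (i, j)" by (auto simp: V_def)
    have "adj V * V = 1\<^sub>m ?n"
    proof (rule eq_matI)
      fix i j assume "i < dim_row (1\<^sub>m ?n)" "j < dim_col (1\<^sub>m ?n)"
      then have ij: "i < ?n" "j < ?n" by auto
      have "(adj V * V) $$ (i, j) = (\<Sum>k<?n. cnj (V $$ (k, i)) * V $$ (k, j))"
        using ij cV by (auto simp: scalar_prod_def atLeast0LessThan intro!: sum.cong)
      also have "\<dots> = cnj (V $$ (0, i)) * V $$ (0, j) + (\<Sum>k<m. cnj (V $$ (Suc k, i)) * V $$ (Suc k, j))"
        by (simp only: sum.lessThan_Suc_shift)
      also have "\<dots> = 1\<^sub>m ?n $$ (i, j)"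
      proof (cases "i = 0 \<or> j = 0")
        case True
        then show ?thesis using ij by (cases i; cases j) (auto simp: Vi)
      next
        case False
        then obtain i' j' where s: "i = Suc i'" "j = Suc j'" by (cases i; cases j) auto
        have "(\<Sum>k<m. cnj (V $$ (Suc k, i)) * V $$ (Suc k, j)) = (adj U' * U') $$ (i', j')"
          using ij cU' s by (auto simp: Vi scalar_prod_def atLeast0LessThan intro!: sum.cong)
        then show ?thesis using ij s U' by (simp add: Vi unitary_mat_def)
      qed
      finally show "(adj V * V) $$ (i, j) = 1\<^sub>m ?n $$ (i, j)" .
    qed (use cV in simp_all)
    moreover from this have "V * adj V = 1\<^sub>m ?n"
      using mat_mult_left_right_inverse[of "adj V" ?n V] cV by (simp add: mat_adjoint_carrier)
    ultimately have V: "unitary_mat ?n V" using cV by (simp add: unitary_mat_def)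
    have "B = spec ?n V d"
    proof (rule eq_matI)
      fix i j assume "i < dim_row (spec ?n V d)" "j < dim_col (spec ?n V d)"
      then have ij: "i < ?n" "j < ?n" using spec_carrier[OF V, of d] by auto
      have "spec ?n V d $$ (i, j) = of_real (d 0) * V $$ (i, 0) * cnj (V $$ (j, 0)) +
          (\<Sum>k<m. of_real (d (Suc k)) * V $$ (i, Suc k) * cnj (V $$ (j, Suc k)))"
        unfolding spec_index[OF V ij] by (simp only: sum.lessThan_Suc_shift)
      also have "\<dots> = B $$ (i, j)"
      proof (cases "i = 0 \<or> j = 0")
        case True
        then show ?thesis using ij e by (cases i; cases j) (auto simp: Vi d_def B0 B0')
      next
        case False
        then obtain i' j' where s: "i = Suc i'" "j = Suc j'" by (cases i; cases j) auto
        have "(\<Sum>k<m. of_real (d (Suc k)) * V $$ (i, Suc k) * cnj (V $$ (j, Suc k))) = spec m U' d' $$ (i', j')"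
          using ij s by (auto simp: Vi spec_index[OF U'] d_def intro!: sum.cong)
        also have "\<dots> = A' $$ (i', j')" by (simp add: A')
        also have "\<dots> = B $$ (i, j)" using ij s by (simp add: A'_def)
        finally show ?thesis using ij s by (simp add: Vi)
      qed
      finally show "B $$ (i, j) = spec ?n V d $$ (i, j)" by simp
    qed (use cB carrier_matD[OF spec_carrier[OF V]] in auto)
    moreover have "A = W * B * adj W"
    proof -
      have "W * B * adj W = W * (adj W * (A * (W * adj W)))"
        unfolding B_def using cW A by (simp add: assoc_mult_mat[of _ ?n ?n _ ?n _ ?n] mult_carrier_mat[of _ ?n ?n])
      also have "\<dots> = A" using W A cW by (simp add: unitary_cancel(2)[OF W, of _ ?n]) (simp add: unitary_mat_def)
      finally show ?thesis by simp
    qed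
    ultimately have "A = spec ?n (W * V) d" by (simp add: spec_unitary_mult[OF W V])
    then show ?case using unitary_mult[OF W V] by blast
  qed
  then show thesis using that by blast
qed

lemma psd_spectral:
  assumes "psd_mat n A"
  obtains U d where "unitary_mat n U" "A = spec n U d" "\<And>i. i < n \<Longrightarrow> 0 \<le> d i"
  using spectral_theorem[OF psd_carrier[OF assms] psd_hermitian[OF assms]] psd_spec_nonneg assms
  by metis


subsection \<open>Overlaps of eigenbases and the scalar inequality\<close>

text \<open>For unitary \<open>U\<close> and \<open>V\<close> with columns u_i and v_j this is the
  transition probability \<open>|<u_i, v_j>|^2\<close>. It forms a doubly stochastic matrix, so a
  sum over either spectrum becomes a double sum that can be compared term by term.\<close>

definition overlap :: "complex mat \<Rightarrow> complex mat \<Rightarrow> nat \<Rightarrow> nat \<Rightarrow> real" where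
  "overlap U V i j = (cmod ((adj U * V) $$ (i, j)))\<^sup>2"

lemma overlap_nonneg [simp]: "0 \<le> overlap U V i j"
  by (simp add: overlap_def)

lemma overlap_row_sum: "unitary_mat n U \<Longrightarrow> unitary_mat n V \<Longrightarrow> i < n \<Longrightarrow> (\<Sum>j<n. overlap U V i j) = 1"
  and overlap_col_sum: "unitary_mat n U \<Longrightarrow> unitary_mat n V \<Longrightarrow> j < n \<Longrightarrow> (\<Sum>i<n. overlap U V i j) = 1"
  unfolding overlap_def by (simp_all add: unitary_row_sum unitary_col_sum unitary_mult unitary_adj)

lemma sum_overlap_left:
  assumes "unitary_mat n U" "unitary_mat n V"
  shows "(\<Sum>i<n. \<Sum>j<n. overlap U V i j * f i) = (\<Sum>i<n. f i)"
  using overlap_row_sum[OF assms] by (simp add: sum_distrib_right[symmetric])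

lemma sum_overlap_right:
  assumes "unitary_mat n U" "unitary_mat n V"
  shows "(\<Sum>i<n. \<Sum>j<n. overlap U V i j * f j) = (\<Sum>j<n. f j)"
  using overlap_col_sum[OF assms] by (subst sum.swap) (simp add: sum_distrib_right[symmetric])

text \<open>A weighted squared Hilbert-Schmidt norm of \<open>Y\<close>. The basis \<open>V\<close>
  is free here; it is carried along so that the same entries of \<open>Y\<close> occur as in
  \<open>mat_trace_spec_right\<close>.\<close>

lemma mat_trace_spec_left:
  assumes U: "unitary_mat n U" and V: "unitary_mat n V" and Y: "Y \<in> carrier_mat n n"
  shows "mat_trace (adj Y * spec n U z * Y)
    = of_real (\<Sum>i<n. \<Sum>j<n. z i * (cmod ((adj U * Y * V) $$ (i, j)))\<^sup>2)"
proof -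
  note c = unitary_carrier[OF U] unitary_adj_carrier[OF U] unitary_carrier[OF V] unitary_adj_carrier[OF V]
    Y mat_adjoint_carrier[OF Y]
  note ms = assoc_mult_mat[of _ n n _ n _ n] mult_carrier_mat[of _ n n]
  define D where "D = mat_diag n (\<lambda>i. complex_of_real (z i))"
  have D: "D \<in> carrier_mat n n" by (simp add: D_def)
  define W where "W = adj U * Y * V"
  have W: "W \<in> carrier_mat n n" using c by (simp add: W_def ms)
  note W' = mat_adjoint_carrier[OF W]
  define T where "T = adj Y * (U * (D * (adj U * Y)))"
  have T: "T \<in> carrier_mat n n" using c D by (simp add: T_def ms)
  \<comment> \<open>Inserting \<open>V * adj V\<close> introduces the second basis.\<close>
  have "mat_trace (adj Y * spec n U z * Y) = mat_trace (T * (V * adj V))"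
    using V T c D by (simp add: spec_def T_def D_def[symmetric] unitary_mat_def ms)
  also have "\<dots> = mat_trace ((T * V) * adj V)" using T c by (simp add: ms)
  also have "\<dots> = mat_trace (adj V * (T * V))" using T c by (intro mat_trace_comm[of _ n n]) (simp_all add: ms)
  also have "adj V * (T * V) = adj W * (D * W)"
    using c D by (simp add: T_def W_def adj_mult[of _ n n _ n] ms)
  also have "mat_trace \<dots> = (\<Sum>i<n. \<Sum>j<n. cnj (W $$ (j, i)) * (of_real (z j) * W $$ (j, i)))"
    using W W' D by (subst mat_trace_mult[of _ n n]) (auto simp: ms D_def mat_diag_mult_left[of _ n n] intro!: sum.cong)
  also have "\<dots> = of_real (\<Sum>j<n. \<Sum>i<n. z j * (cmod (W $$ (j, i)))\<^sup>2)"
    by (subst sum.swap) (simp add: complex_norm_square mult_ac del: of_real_power)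
  finally show ?thesis by (simp add: W_def)
qed

lemma mat_trace_spec_right:
  assumes U: "unitary_mat n U" and V: "unitary_mat n V" and Y: "Y \<in> carrier_mat n n"
  shows "mat_trace (Y * spec n V d * adj Y)
    = of_real (\<Sum>i<n. \<Sum>j<n. d j * (cmod ((adj U * Y * V) $$ (i, j)))\<^sup>2)"
proof -
  note c = unitary_carrier[OF U] unitary_adj_carrier[OF U] unitary_carrier[OF V] unitary_adj_carrier[OF V]
    Y mat_adjoint_carrier[OF Y]
  note ms = assoc_mult_mat[of _ n n _ n _ n] mult_carrier_mat[of _ n n]
  have e: "(adj V * adj Y * U) $$ (j, i) = cnj ((adj U * Y * V) $$ (i, j))" if "i < n" "j < n" for i j
  proof -
    have "adj V * adj Y * U = adj (adj U * Y * V)" using c by (simp add: adj_mult[of _ n n _ n] ms)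
    then show ?thesis using c that by simp
  qed
  \<comment> \<open>The left version for \<open>adj Y\<close> with the two bases exchanged.\<close>
  have "mat_trace (Y * spec n V d * adj Y)
    = of_real (\<Sum>j<n. \<Sum>i<n. d j * (cmod ((adj V * adj Y * U) $$ (j, i)))\<^sup>2)"
    using mat_trace_spec_left[OF V U c(6), of d] by simp
  also have "\<dots> = of_real (\<Sum>j<n. \<Sum>i<n. d j * (cmod ((adj U * Y * V) $$ (i, j)))\<^sup>2)"
    by (intro arg_cong[of _ _ of_real] sum.cong refl) (simp add: e)
  also have "\<dots> = of_real (\<Sum>i<n. \<Sum>j<n. d j * (cmod ((adj U * Y * V) $$ (i, j)))\<^sup>2)"
    by (subst sum.swap) simp
  finally show ?thesis .
qed

text \<open>The trace is the Hilbert-Schmidt inner product of \<open>Y\<close> with the identity,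
  and \<open>adj U * V\<close> is the identity written between the two bases.\<close>

lemma mat_trace_overlap:
  assumes U: "unitary_mat n U" and V: "unitary_mat n V" and Y: "Y \<in> carrier_mat n n"
  shows "mat_trace Y = (\<Sum>i<n. \<Sum>j<n. (adj U * Y * V) $$ (i, j) * cnj ((adj U * V) $$ (i, j)))"
proof -
  note c = unitary_carrier[OF U] unitary_adj_carrier[OF U] unitary_carrier[OF V] unitary_adj_carrier[OF V]
    Y mat_adjoint_carrier[OF Y]
  note ms = assoc_mult_mat[of _ n n _ n _ n] mult_carrier_mat[of _ n n]
  have "(adj U * Y * V) * (adj V * U) = adj U * (Y * U)"
    using c unitary_cancel(2)[OF V, of U] by (simp add: ms)
  also have "mat_trace \<dots> = mat_trace ((Y * U) * adj U)"
    using c by (intro mat_trace_comm[of _ n n]) (simp_all add: ms)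
  also have "(Y * U) * adj U = Y" using c U by (simp add: ms unitary_mat_def)
  finally have "mat_trace Y = mat_trace ((adj U * Y * V) * (adj V * U))" by simp
  also have "\<dots> = (\<Sum>i<n. \<Sum>j<n. (adj U * Y * V) $$ (i, j) * (adj V * U) $$ (j, i))"
    using c by (intro mat_trace_mult) (simp_all add: ms)
  also have "\<dots> = (\<Sum>i<n. \<Sum>j<n. (adj U * Y * V) $$ (i, j) * cnj ((adj U * V) $$ (i, j)))"
  proof (intro sum.cong refl)
    fix i j assume "i \<in> {..<n}" "j \<in> {..<n}"
    moreover have "adj V * U = adj (adj U * V)" using c by (simp add: adj_mult[of _ n n _ n])
    ultimately have "(adj V * U) $$ (j, i) = cnj ((adj U * V) $$ (i, j))" using c by simp
    then show "(adj U * Y * V) $$ (i, j) * (adj V * U) $$ (j, i)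
      = (adj U * Y * V) $$ (i, j) * cnj ((adj U * V) $$ (i, j))" by simp
  qed
  finally show ?thesis .
qed

text \<open>Young's inequality, from the square of \<open>s * cmod y - cmod w\<close> divided by
  \<open>s\<close>.\<close>

lemma two_Re_mult_cnj_le:
  assumes "0 < s"
  shows "2 * Re (y * cnj w) \<le> s * (cmod y)\<^sup>2 + (cmod w)\<^sup>2 / s"
proof -
  have "Re (y * cnj w) \<le> cmod y * cmod w" using complex_Re_le_cmod[of "y * cnj w"] by (simp add: norm_mult)
  moreover have "0 \<le> (s * cmod y - cmod w)\<^sup>2 / s" using assms by simp
  then have "2 * (cmod y * cmod w) \<le> s * (cmod y)\<^sup>2 + (cmod w)\<^sup>2 / s"
    using assms by (simp add: power2_diff add_divide_distrib diff_divide_distrib power2_eq_square algebra_simps)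
  ultimately show ?thesis by linarith
qed

text \<open>With \<open>Y = (Z + D)\<^sup>-\<^sup>1\<close>, both \<open>tr Y\<close> and \<open>tr (Y Z Y) + tr (Y D Y)\<close> are the left-hand side;
  in the eigenbases of \<open>Z\<close> and \<open>D\<close> the inequality between the linear and the quadratic
  expression holds entrywise.\<close>

lemma trace_inverse_le:
  assumes U: "unitary_mat n U" and V: "unitary_mat n V" and X: "unitary_mat n X"
    and sum: "spec n X h = spec n U z + spec n V d"
    and pos: "\<And>i. i < n \<Longrightarrow> 0 < z i" "\<And>i. i < n \<Longrightarrow> 0 < d i" "\<And>i. i < n \<Longrightarrow> 0 < h i"
  shows "(\<Sum>k<n. 1 / h k) \<le> (\<Sum>i<n. \<Sum>j<n. overlap U V i j / (z i + d j))"
proof -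
  note ms = assoc_mult_mat[of _ n n _ n _ n] mult_carrier_mat[of _ n n]
  define Y where "Y = spec n X (\<lambda>k. 1 / h k)"
  have Y: "Y \<in> carrier_mat n n" "adj Y = Y" using X by (auto simp: Y_def adj_spec)
  define y w where "y i j = (adj U * Y * V) $$ (i, j)" and "w i j = (adj U * V) $$ (i, j)" for i j
  have "Y * spec n X h * Y = spec n X (\<lambda>k. 1 / h k)"
    unfolding Y_def spec_mult[OF X] by (rule spec_cong) (use pos(3) in force)
  then have "complex_of_real (\<Sum>k<n. 1 / h k) = mat_trace (Y * (spec n U z + spec n V d) * Y)"
    unfolding sum[symmetric] by (simp add: mat_trace_spec[OF X])
  also have "Y * (spec n U z + spec n V d) * Y = adj Y * spec n U z * Y + Y * spec n V d * adj Y"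
    using Y U V by (simp add: mult_add_distrib_mat[of _ n n _ n] add_mult_distrib_mat[of _ n n _ _ n] ms)
  also have "mat_trace \<dots> = of_real (\<Sum>i<n. \<Sum>j<n. (z i + d j) * (cmod (y i j))\<^sup>2)"
    unfolding distrib_right sum.distrib y_def of_real_add
      mat_trace_spec_left[OF U V Y(1), symmetric] mat_trace_spec_right[OF U V Y(1), symmetric]
    by (rule mat_trace_add[of _ n]) (use Y U V in \<open>auto intro!: mult_carrier_mat[of _ n n]\<close>)
  finally have q: "(\<Sum>k<n. 1 / h k) = (\<Sum>i<n. \<Sum>j<n. (z i + d j) * (cmod (y i j))\<^sup>2)"
    using of_real_eq_iff by blast
  have "complex_of_real (\<Sum>k<n. 1 / h k) = mat_trace Y"
    unfolding Y_def by (simp add: mat_trace_spec[OF X])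
  also have "\<dots> = (\<Sum>i<n. \<Sum>j<n. y i j * cnj (w i j))"
    unfolding y_def w_def by (rule mat_trace_overlap[OF U V Y(1)])
  finally have "(\<Sum>k<n. 1 / h k) = Re (\<Sum>i<n. \<Sum>j<n. y i j * cnj (w i j))"
    by (metis Re_complex_of_real)
  then have "2 * (\<Sum>k<n. 1 / h k) = (\<Sum>i<n. \<Sum>j<n. 2 * Re (y i j * cnj (w i j)))"
    by (simp add: sum_distrib_left)
  \<comment> \<open>Young's inequality with weight \<open>z i + d j\<close>, for which the first
    terms add up to the quadratic expression.\<close>
  also have "\<dots> \<le> (\<Sum>i<n. \<Sum>j<n. (z i + d j) * (cmod (y i j))\<^sup>2 + overlap U V i j / (z i + d j))"
    unfolding overlap_def w_def[symmetric]
    by (intro sum_mono two_Re_mult_cnj_le) (use pos in \<open>auto intro: add_pos_pos\<close>)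
  \<comment> \<open>By \<open>q\<close> the quadratic part is again the left-hand side of the claim,
    so one of its two copies cancels.\<close>
  also have "\<dots> = (\<Sum>k<n. 1 / h k) + (\<Sum>i<n. \<Sum>j<n. overlap U V i j / (z i + d j))"
    by (simp add: q sum.distrib)
  finally show ?thesis by simp
qed

text \<open>Takes the place of an integral over t > 0: as \<open>R\<close> vanishes at infinity,
  \<open>R 0\<close> is the total decrease of \<open>R\<close>. Differentiability is asked only for
  t > 0, because x ln x has no derivative at 0.\<close>

lemma nonneg_if_deriv_nonpos:
  fixes R :: "real \<Rightarrow> real"
  assumes der: "\<And>t. 0 < t \<Longrightarrow> (R has_real_derivative R' t) (at t)"
    and neg: "\<And>t. 0 < t \<Longrightarrow> R' t \<le> 0"
    and lim0: "(R \<longlongrightarrow> R 0) (at_right 0)" and lim: "(R \<longlongrightarrow> 0) at_top"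
  shows "0 \<le> R 0"
proof -
  have "0 \<le> R s" if s: "0 < s" for s
  proof (rule tendsto_upperbound[OF lim])
    show "eventually (\<lambda>t. R t \<le> R s) at_top"
      using eventually_ge_at_top[of s]
    proof eventually_elim
      case (elim t)
      show ?case
        by (rule DERIV_nonpos_imp_nonincreasing[OF elim]) (use s der neg in \<open>meson less_le_trans\<close>)
    qed
  qed simp
  then have "eventually (\<lambda>s. 0 \<le> R s) (at_right 0)"
    by (simp add: eventually_at_filter)
  then show ?thesis by (intro tendsto_lowerbound[OF lim0]) auto
qed

lemma spec_shift:
  assumes U: "unitary_mat n U"
  shows "spec n U (\<lambda>i. f i + t) = spec n U f + of_real t \<cdot>\<^sub>m 1\<^sub>m n"
  using spec_add[OF U, of f "\<lambda>i. t"] spec_smult[OF U, of t "\<lambda>_. 1"] spec_one[OF U] by simp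

text \<open>\<open>trace_inverse_le\<close> for \<open>Z + t/2\<close> and \<open>D + t/2\<close> integrated over \<open>t > 0\<close>.\<close>

lemma sum_ln_ge_overlap:
  assumes U: "unitary_mat n U" and V: "unitary_mat n V" and X: "unitary_mat n X"
    and sum: "spec n X h = spec n U z + spec n V d"
    and pos: "\<And>i. i < n \<Longrightarrow> 0 < z i" "\<And>i. i < n \<Longrightarrow> 0 < d i" "\<And>i. i < n \<Longrightarrow> 0 < h i"
  shows "(\<Sum>i<n. \<Sum>j<n. overlap U V i j * ln (z i + d j)) \<le> (\<Sum>k<n. ln (h k))"
proof -
  define R where "R t = (\<Sum>k<n. ln (h k + t)) - (\<Sum>i<n. \<Sum>j<n. overlap U V i j * ln (z i + d j + t))" for t
  define R' where "R' t = (\<Sum>k<n. 1 / (h k + t)) - (\<Sum>i<n. \<Sum>j<n. overlap U V i j * (1 / (z i + d j + t)))" for t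
  have der: "(R has_real_derivative R' t) (at t)" if "0 \<le> t" for t
  proof -
    have "0 < h k + t" "0 < z k + d j + t" if "k < n" "j < n" for k j
      using pos(3)[OF that(1)] pos(1)[OF that(1)] pos(2)[OF that(2)] \<open>0 \<le> t\<close> by auto
    then show ?thesis unfolding R_def R'_def by (auto intro!: derivative_eq_intros sum.cong)
  qed
  have "0 \<le> R 0"
  proof (rule nonneg_if_deriv_nonpos)
    fix t :: real assume t: "0 < t"
    show "(R has_real_derivative R' t) (at t)" using der t by simp
    have "spec n X (\<lambda>k. h k + t) = spec n U (\<lambda>i. z i + t / 2) + spec n V (\<lambda>i. d i + t / 2)"
      unfolding spec_shift[OF U] spec_shift[OF V] spec_shift[OF X] sum
      using carrier_matD[OF spec_carrier[OF U]] carrier_matD[OF spec_carrier[OF V]]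
      by (intro eq_matI) auto
    from trace_inverse_le[OF U V X this] pos t show "R' t \<le> 0"
      by (simp add: R'_def add_pos_pos add.assoc add.left_commute)
  next
    show "(R \<longlongrightarrow> R 0) (at_right 0)"
      using DERIV_isCont[OF der[of 0]] by (simp add: isCont_def filterlim_at_split)
    \<comment> \<open>The overlaps have total weight n, so n copies of \<open>ln t\<close> may be
      subtracted from both sums; afterwards every term tends to 0.\<close>
    have eq: "R t = (\<Sum>k<n. ln (h k + t) - ln t) - (\<Sum>i<n. \<Sum>j<n. overlap U V i j * (ln (z i + d j + t) - ln t))" for t
      using sum_overlap_left[OF U V, of "\<lambda>_. ln t"]
      by (simp add: R_def sum_subtractf right_diff_distrib)
    have l: "((\<lambda>t. ln (c + t) - ln t) \<longlongrightarrow> 0) at_top" for c :: real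
      by real_asymp
    have "(R \<longlongrightarrow> (\<Sum>k<n. 0) - (\<Sum>i<n. \<Sum>j<n. overlap U V i j * 0)) at_top"
      unfolding eq by (intro tendsto_intros l)
    then show "(R \<longlongrightarrow> 0) at_top" by simp
  qed
  then show ?thesis by (simp add: R_def)
qed


section \<open>The scalar inequality for ln cosh\<close>

lemma mult_sech2_le_tanh:
  fixes x :: real
  assumes "0 \<le> x"
  shows "x * (1 - (tanh x)\<^sup>2) \<le> tanh x"
proof -
  have "((\<lambda>x::real. x * (1 - (tanh x)\<^sup>2) - tanh x) has_real_derivative
      - 2 * t * tanh t * (1 - (tanh t)\<^sup>2)) (at t)" for t
    by (auto intro!: derivative_eq_intros simp: algebra_simps)
  moreover have "- 2 * t * tanh t * (1 - (tanh t)\<^sup>2) \<le> 0" if "0 \<le> t" for t :: real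
  proof -
    have "\<bar>tanh t\<bar> \<le> 1" using tanh_real_bounds[of t] by (simp add: abs_le_iff)
    then have "(tanh t)\<^sup>2 \<le> 1" by (simp add: abs_square_le_1)
    then have "0 \<le> t * tanh t * (1 - (tanh t)\<^sup>2)" using that by (intro mult_nonneg_nonneg) auto
    then show ?thesis by simp
  qed
  ultimately have "x * (1 - (tanh x)\<^sup>2) - tanh x \<le> 0 * (1 - (tanh 0)\<^sup>2) - tanh (0::real)"
    by (intro DERIV_nonpos_imp_nonincreasing[OF assms]) blast
  then show ?thesis by simp
qed

text \<open>Both sides vanish at 0, and the derivative of their difference is nonpositive by
  \<open>mult_sech2_le_tanh\<close>.\<close>

lemma mult_tanh_le_ln_cosh:
  fixes x :: real
  assumes "0 \<le> x"
  shows "x * tanh x \<le> 2 * ln (cosh x)"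
proof -
  have "((\<lambda>x::real. x * tanh x - 2 * ln (cosh x)) has_real_derivative
      t * (1 - (tanh t)\<^sup>2) - tanh t) (at t)" for t
    by (auto intro!: derivative_eq_intros simp: tanh_def[symmetric] algebra_simps)
  then have "x * tanh x - 2 * ln (cosh x) \<le> 0 * tanh 0 - 2 * ln (cosh (0::real))"
    using mult_sech2_le_tanh by (intro DERIV_nonpos_imp_nonincreasing[OF assms]) force
  then show ?thesis by simp
qed

text \<open>The quotient of \<open>ln (cosh x)\<close> by the square of x decreases, since the
  numerator of its derivative has the sign given by \<open>mult_tanh_le_ln_cosh\<close>.\<close>

lemma ln_cosh_div_square_antimono:
  fixes x y :: real
  assumes "0 < x" "x \<le> y"
  shows "ln (cosh y) * x\<^sup>2 \<le> ln (cosh x) * y\<^sup>2"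
proof -
  have "ln (cosh y) / y\<^sup>2 \<le> ln (cosh x) / x\<^sup>2"
  proof (rule DERIV_nonpos_imp_nonincreasing[OF assms(2)])
    fix t assume "x \<le> t" "t \<le> y"
    then have t: "0 < t" using assms by simp
    have sinh_eq: "sinh t = cosh t * tanh t" by (simp add: tanh_def)
    have "((\<lambda>x. ln (cosh x) / x\<^sup>2) has_real_derivative (t * tanh t - 2 * ln (cosh t)) / t ^ 3) (at t)"
      using t by (auto intro!: derivative_eq_intros
          simp: sinh_eq field_simps power2_eq_square power3_eq_cube)
    moreover have "(t * tanh t - 2 * ln (cosh t)) / t ^ 3 \<le> 0"
      using t mult_tanh_le_ln_cosh[of t] by (simp add: divide_nonpos_pos)
    ultimately show "\<exists>y. ((\<lambda>x. ln (cosh x) / x\<^sup>2) has_real_derivative y) (at t) \<and> y \<le> 0" by blast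
  qed
  then show ?thesis using assms by (simp add: field_simps)
qed

text \<open>Subadditivity of the square root of ln cosh, in weighted form. With
  \<open>w = |u| + |v|\<close>, the values g u and g v are at least g w times the ratio of squared
  arguments, and the squares satisfy the same weighted inequality.\<close>

lemma ln_cosh_add_le:
  fixes u v l :: real
  assumes l: "0 < l"
  shows "ln (cosh (u + v)) \<le> (1 + l) * ln (cosh u) + (1 + 1 / l) * ln (cosh v)"
proof -
  define g where "g x = ln (cosh x)" for x :: real
  define w where "w = \<bar>u\<bar> + \<bar>v\<bar>"
  have g_abs: "g \<bar>x\<bar> = g x" for x by (simp add: g_def)
  have g0: "0 \<le> g x" for x by (simp add: g_def cosh_real_ge_1)
  have "cosh \<bar>u + v\<bar> \<le> cosh w" unfolding w_def by (subst cosh_real_nonneg_le_iff) auto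
  then have g1: "g (u + v) \<le> g w" by (simp add: g_def cosh_real_pos)
  have g2: "g w * u\<^sup>2 \<le> g u * w\<^sup>2" if "u \<noteq> 0 \<or> v \<noteq> 0"
    using ln_cosh_div_square_antimono[of "\<bar>u\<bar>" w] g0 by (cases "u = 0") (auto simp: g_def w_def)
  have g3: "g w * v\<^sup>2 \<le> g v * w\<^sup>2" if "u \<noteq> 0 \<or> v \<noteq> 0"
    using ln_cosh_div_square_antimono[of "\<bar>v\<bar>" w] g0 by (cases "v = 0") (auto simp: g_def w_def)
  show ?thesis
  proof (cases "u = 0 \<and> v = 0")
    case False
    then have w: "0 < w\<^sup>2" by (auto simp: w_def)
    have "w\<^sup>2 \<le> (1 + l) * u\<^sup>2 + (1 + 1 / l) * v\<^sup>2"
    proof -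
      \<comment> \<open>Expanding this square bounds twice the product of the absolute values by the
        two weighted squares.\<close>
      have "0 \<le> (l * \<bar>u\<bar> - \<bar>v\<bar>)\<^sup>2 / l" using l by simp
      then show ?thesis using l
        by (simp add: w_def power2_diff power2_sum add_divide_distrib diff_divide_distrib power2_eq_square algebra_simps)
    qed
    then have "g w * w\<^sup>2 \<le> (1 + l) * (g w * u\<^sup>2) + (1 + 1 / l) * (g w * v\<^sup>2)"
      using mult_left_mono[OF _ g0[of w]] by (fastforce simp: algebra_simps)
    also have "\<dots> \<le> (1 + l) * (g u * w\<^sup>2) + (1 + 1 / l) * (g v * w\<^sup>2)"
      using l False by (intro add_mono mult_left_mono g2 g3) auto
    also have "\<dots> = ((1 + l) * g u + (1 + 1 / l) * g v) * w\<^sup>2" by (simp add: algebra_simps)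
    finally have "g w \<le> (1 + l) * g u + (1 + 1 / l) * g v" using w by simp
    then show ?thesis using g1 unfolding g_def by linarith
  qed simp
qed

text \<open>The Jensen gap of the logarithm: the logarithm of the arithmetic mean over the geometric
  mean.\<close>

definition log_jensen :: "real \<Rightarrow> real \<Rightarrow> real" where
  "log_jensen a b = ln ((a + b) / 2) - (ln a + ln b) / 2"

text \<open>Dividing a and b by their geometric mean gives \<open>exp x\<close> and
  \<open>exp (- x)\<close> for x half the difference of the logarithms, and the average of these is
  \<open>cosh x\<close>.\<close>

lemma log_jensen_eq_ln_cosh:
  assumes "0 < a" "0 < b"
  shows "log_jensen a b = ln (cosh ((ln a - ln b) / 2))"
proof -
  have "cosh ((ln a - ln b) / 2) = (a + b) / 2 * exp (- ((ln a + ln b) / 2))"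
  proof -
    have "a * exp (- ((ln a + ln b) / 2)) = exp ((ln a - ln b) / 2)"
      "b * exp (- ((ln a + ln b) / 2)) = exp ((ln b - ln a) / 2)"
      using exp_add[of "ln a" "- ((ln a + ln b) / 2)"] exp_add[of "ln b" "- ((ln a + ln b) / 2)"] assms
      by (simp_all add: field_simps)
    moreover have "- ((ln a - ln b) / 2) = (ln b - ln a) / 2" by (metis minus_diff_eq minus_divide_left)
    ultimately show ?thesis by (simp only: cosh_def distrib_right) (simp add: cosh_def distrib_right)
  qed
  then have "ln (cosh ((ln a - ln b) / 2)) = ln ((a + b) / 2 * exp (- ((ln a + ln b) / 2)))" by (simp only:)
  also have "\<dots> = ln ((a + b) / 2) - (ln a + ln b) / 2"
    using assms by (subst ln_mult_pos) auto
  finally show ?thesis by (simp only: log_jensen_def)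
qed

lemma log_jensen_triangle:
  assumes "0 < a" "0 < b" "0 < c" "0 < l"
  shows "log_jensen a b \<le> (1 + l) * log_jensen a c + (1 + 1 / l) * log_jensen c b"
proof -
  have eq: "(ln a - ln b) / 2 = (ln a - ln c) / 2 + (ln c - ln b) / 2" by (simp add: field_simps)
  show ?thesis
    unfolding log_jensen_eq_ln_cosh[OF assms(1,2)] log_jensen_eq_ln_cosh[OF assms(1,3)]
      log_jensen_eq_ln_cosh[OF assms(3,2)] eq
    by (rule ln_cosh_add_le[OF assms(4)])
qed


subsection \<open>The log-determinant divergence\<close>

lemma psd_spec:
  assumes U: "unitary_mat n U" and d: "\<And>i. i < n \<Longrightarrow> 0 \<le> d i"
  shows "psd_mat n (spec n U d)"
proof -
  have "psd_mat n (mat_diag n (\<lambda>i. complex_of_real (d i)))"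
  proof (rule psd_matI)
    fix v :: "nat \<Rightarrow> complex"
    have "(\<Sum>i<n. \<Sum>j<n. mat_diag n (\<lambda>i. complex_of_real (d i)) $$ (i, j) * v j * cnj (v i))
      = (\<Sum>i<n. \<Sum>j<n. of_real (d i) * v j * cnj (v i) * (if j = i then 1 else 0))"
      by (intro sum.cong) (auto simp: mat_diag_index)
    also have "\<dots> = (\<Sum>i<n. of_real (d i * (cmod (v i))\<^sup>2))"
      by (intro sum.cong refl) (simp only: sum_mult_delta lessThan_iff, simp add: complex_norm_square mult.assoc del: of_real_power)
    also have "0 \<le> \<dots>" using d by (auto intro!: sum_nonneg simp: less_eq_complex_def simp flip: of_real_power)
    finally show "0 \<le> (\<Sum>i<n. \<Sum>j<n. mat_diag n (\<lambda>i. complex_of_real (d i)) $$ (i, j) * v j * cnj (v i))" .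
  qed simp
  from psd_congruence[OF this unitary_carrier[OF U]] show ?thesis by (simp add: spec_def)
qed

text \<open>The least eigenvalue \<open>e\<close> of the strictly positive summand can be subtracted
  from it; the sum then stays positive semidefinite, so no eigenvalue of the original sum lies below
  \<open>e\<close>.\<close>

lemma spec_sum_pos:
  assumes U: "unitary_mat n U" and V: "unitary_mat n V" and X: "unitary_mat n X"
    and sum: "spec n X h = spec n U z + spec n V d"
    and z: "\<And>i. i < n \<Longrightarrow> 0 < z i" and d: "\<And>i. i < n \<Longrightarrow> 0 \<le> d i" and k: "k < n"
  shows "0 < h k"
proof -
  define e where "e = Min (z ` {..<n})"
  have e: "0 < e" "\<And>i. i < n \<Longrightarrow> e \<le> z i" using z k by (auto simp: e_def Min_gr_iff lessThan_empty_iff)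
  have "spec n X (\<lambda>k. h k + - e) = spec n U (\<lambda>i. z i + - e) + spec n V d"
    unfolding spec_shift[OF U] spec_shift[OF X] sum
    using carrier_matD[OF spec_carrier[OF U]] carrier_matD[OF spec_carrier[OF V]]
    by (intro eq_matI) auto
  moreover have "psd_mat n (spec n U (\<lambda>i. z i + - e) + spec n V d)"
    using e d by (intro psd_add psd_spec U V) auto
  ultimately have "psd_mat n (spec n X (\<lambda>k. h k + - e))" by simp
  from psd_spec_nonneg[OF X this k] e show ?thesis by simp
qed

text \<open>For a positive semidefinite matrix a nonzero determinant means that all eigenvalues are
  positive. In this form stability under invertible congruence follows from multiplicativity of the
  determinant.\<close>

definition pd_mat :: "nat \<Rightarrow> complex mat \<Rightarrow> bool" where
  "pd_mat n A \<longleftrightarrow> psd_mat n A \<and> det A \<noteq> 0"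

lemma pd_spec:
  assumes "unitary_mat n U" "\<And>i. i < n \<Longrightarrow> 0 < d i"
  shows "pd_mat n (spec n U d)"
proof -
  have "(\<Prod>i<n. \<bar>d i\<bar>) \<noteq> 0" using assms(2) by (auto simp: less_le)
  then show ?thesis
    using assms psd_spec[OF assms(1), of d] cmod_det_spec[OF assms(1), of d]
    by (auto simp: pd_mat_def less_imp_le)
qed

lemma pd_spectral:
  assumes "pd_mat n A"
  obtains U d where "unitary_mat n U" "A = spec n U d" "\<And>i. i < n \<Longrightarrow> 0 < d i"
proof -
  obtain U d where U: "unitary_mat n U" "A = spec n U d" "\<And>i. i < n \<Longrightarrow> 0 \<le> d i"
    using psd_spectral[of n A] assms unfolding pd_mat_def by metis
  have "(\<Prod>i<n. \<bar>d i\<bar>) \<noteq> 0" using assms unfolding pd_mat_def U(2) cmod_det_spec[OF U(1), symmetric] by simp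
  then have "d i \<noteq> 0" if "i < n" for i using that by (metis abs_zero finite_lessThan lessThan_iff prod_zero_iff)
  with U show thesis by (intro that[of U d]) (auto simp: less_le)
qed

lemma pd_carrier: "pd_mat n A \<Longrightarrow> A \<in> carrier_mat n n"
  by (simp add: pd_mat_def psd_carrier)

lemma pd_add:
  assumes "pd_mat n A" "psd_mat n B"
  shows "pd_mat n (A + B)"
proof -
  obtain U z where U: "unitary_mat n U" "A = spec n U z" "\<And>i. i < n \<Longrightarrow> 0 < z i"
    using pd_spectral[OF assms(1)] by blast
  obtain V d where V: "unitary_mat n V" "B = spec n V d" "\<And>i. i < n \<Longrightarrow> 0 \<le> d i"
    using psd_spectral[OF assms(2)] by blast
  have "psd_mat n (A + B)" using assms by (simp add: psd_add pd_mat_def)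
  then obtain X h where X: "unitary_mat n X" "A + B = spec n X h" using psd_spectral by blast
  have "0 < h k" if "k < n" for k
    by (rule spec_sum_pos[OF U(1) V(1) X(1) _ U(3) V(3) that]) (use U V X in simp_all)
  then show ?thesis unfolding X(2) by (intro pd_spec X)
qed

text \<open>The modulus only makes the determinant a real number: for a positive definite matrix the
  determinant is already positive.\<close>

definition log_det :: "complex mat \<Rightarrow> real" where
  "log_det A = ln (cmod (det A))"

lemma log_det_spec:
  assumes "unitary_mat n U" "\<And>i. i < n \<Longrightarrow> 0 < f i"
  shows "log_det (spec n U f) = (\<Sum>i<n. ln (f i))"
proof -
  have "(\<Prod>i<n. \<bar>f i\<bar>) = (\<Prod>i<n. f i)" using assms(2) by (intro prod.cong) (auto simp: abs_of_pos)
  moreover have "ln (\<Prod>i<n. f i) = (\<Sum>i<n. ln (f i))" using assms(2) by (intro ln_prod) (auto simp: less_le)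
  ultimately show ?thesis by (simp add: log_det_def cmod_det_spec[OF assms(1)])
qed

lemma log_det_mult:
  assumes "A \<in> carrier_mat n n" "B \<in> carrier_mat n n" "det A \<noteq> 0" "det B \<noteq> 0"
  shows "log_det (A * B) = log_det A + log_det B"
  using assms by (simp add: log_det_def det_mult norm_mult ln_mult_pos)

definition mat_mean :: "complex mat \<Rightarrow> complex mat \<Rightarrow> complex mat" where
  "mat_mean A B = (1/2) \<cdot>\<^sub>m (A + B)"

lemma mat_mean_comm: "A \<in> carrier_mat n n \<Longrightarrow> B \<in> carrier_mat n n \<Longrightarrow> mat_mean A B = mat_mean B A"
  unfolding mat_mean_def by (subst comm_add_mat) auto

lemma psd_mean: "psd_mat n A \<Longrightarrow> psd_mat n B \<Longrightarrow> psd_mat n (mat_mean A B)"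
  using psd_smult[OF psd_add, of n A B "1/2"] by (simp add: mat_mean_def)

lemma psd_half: "psd_mat n A \<Longrightarrow> psd_mat n ((1/2) \<cdot>\<^sub>m A)"
  using psd_smult[of n A "1/2"] by simp

lemma spec_half: "unitary_mat n U \<Longrightarrow> (1/2) \<cdot>\<^sub>m spec n U f = spec n U (\<lambda>i. f i / 2)"
  using spec_smult[of n U "1/2" f] by simp

lemma mat_mean_eq:
  "A \<in> carrier_mat n n \<Longrightarrow> B \<in> carrier_mat n n \<Longrightarrow> mat_mean A B = (1/2) \<cdot>\<^sub>m A + (1/2) \<cdot>\<^sub>m B"
  unfolding mat_mean_def by (rule add_smult_distrib_left_mat)

lemma pd_mean:
  assumes "pd_mat n A" "psd_mat n B"
  shows "pd_mat n (mat_mean A B)"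
proof -
  obtain U z where U: "unitary_mat n U" "A = spec n U z" "\<And>i. i < n \<Longrightarrow> 0 < z i"
    using pd_spectral[OF assms(1)] by blast
  have "pd_mat n ((1/2) \<cdot>\<^sub>m A)" unfolding U(2) spec_half[OF U(1)] by (intro pd_spec) (use U in auto)
  then show ?thesis
    using assms psd_half[OF assms(2)] by (simp add: mat_mean_eq[OF pd_carrier psd_carrier] pd_add)
qed

text \<open>Known as the Jensen-Bregman log-determinant divergence or S-divergence.\<close>

definition log_det_div :: "complex mat \<Rightarrow> complex mat \<Rightarrow> real" where
  "log_det_div A B = log_det (mat_mean A B) - (log_det A + log_det B) / 2"

text \<open>\<open>sum_ln_ge_overlap\<close> for the halved matrices bounds the term of the mean
  from below. The other two terms are exact overlap sums by double stochasticity.\<close>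

lemma log_det_div_ge_overlap:
  assumes U: "unitary_mat n U" and V: "unitary_mat n V"
    and pos: "\<And>i. i < n \<Longrightarrow> 0 < z i" "\<And>i. i < n \<Longrightarrow> 0 < d i"
  shows "(\<Sum>i<n. \<Sum>j<n. overlap U V i j * log_jensen (z i) (d j))
    \<le> log_det_div (spec n U z) (spec n V d)"
proof -
  have "pd_mat n (mat_mean (spec n U z) (spec n V d))"
    using pos by (intro pd_mean pd_spec psd_spec U V) (auto intro: less_imp_le)
  then obtain X h where X: "unitary_mat n X" "mat_mean (spec n U z) (spec n V d) = spec n X h"
    "\<And>i. i < n \<Longrightarrow> 0 < h i" using pd_spectral by blast
  have "spec n X h = spec n U (\<lambda>i. z i / 2) + spec n V (\<lambda>i. d i / 2)"
    unfolding X(2)[symmetric] using U V by (simp add: mat_mean_eq[of _ n] spec_half)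
  from sum_ln_ge_overlap[OF U V X(1) this] pos X(3)
  have "(\<Sum>i<n. \<Sum>j<n. overlap U V i j * ln ((z i + d j) / 2)) \<le> log_det (spec n X h)"
    by (simp add: log_det_spec[OF X(1)] add_divide_distrib)
  moreover have "(\<Sum>i<n. \<Sum>j<n. overlap U V i j * log_jensen (z i) (d j)) =
     (\<Sum>i<n. \<Sum>j<n. overlap U V i j * ln ((z i + d j) / 2))
      - ((\<Sum>i<n. \<Sum>j<n. overlap U V i j * ln (z i)) + (\<Sum>i<n. \<Sum>j<n. overlap U V i j * ln (d j))) / 2"
    by (simp add: log_jensen_def right_diff_distrib distrib_left add_divide_distrib sum_subtractf sum.distrib
        sum_divide_distrib)
  ultimately show ?thesis
    using pos by (simp add: log_det_div_def X(2) sum_overlap_left[OF U V] sum_overlap_right[OF U V]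
        log_det_spec[OF U] log_det_spec[OF V])
qed

text \<open>The identity is diagonal in every basis, so in this case the divergence is exactly a sum
  of scalar ones.\<close>

lemma log_det_div_one:
  assumes U: "unitary_mat n U" and pos: "\<And>i. i < n \<Longrightarrow> 0 < z i"
  shows "log_det_div (1\<^sub>m n) (spec n U z) = (\<Sum>i<n. log_jensen 1 (z i))"
proof -
  have "mat_mean (spec n U (\<lambda>_. 1)) (spec n U z) = spec n U (\<lambda>i. (1 + z i) / 2)"
    by (simp add: mat_mean_def spec_add[OF U] spec_half[OF U])
  then have "log_det_div (spec n U (\<lambda>_. 1)) (spec n U z) = (\<Sum>i<n. log_jensen 1 (z i))"
    using pos by (simp add: log_det_div_def log_det_spec[OF U] log_jensen_def add_pos_pos sum_subtractf
        sum_divide_distrib)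
  then show ?thesis by (simp add: spec_one[OF U])
qed

text \<open>The terms that involve the identity are exact, and the one remaining term stands on the
  larger side, where a lower bound suffices. What is left is the scalar inequality averaged with the
  overlaps as weights.\<close>

lemma log_det_div_triangle_one:
  assumes Y: "pd_mat n Y" and Z: "pd_mat n Z" and l: "0 < l"
  shows "log_det_div (1\<^sub>m n) Y \<le> (1 + l) * log_det_div (1\<^sub>m n) Z + (1 + 1 / l) * log_det_div Z Y"
proof -
  obtain U z where U: "unitary_mat n U" "Z = spec n U z" "\<And>i. i < n \<Longrightarrow> 0 < z i"
    using pd_spectral[OF Z] by blast
  obtain V d where V: "unitary_mat n V" "Y = spec n V d" "\<And>i. i < n \<Longrightarrow> 0 < d i"
    using pd_spectral[OF Y] by blast
  note o = sum_overlap_left[OF U(1) V(1)] sum_overlap_right[OF U(1) V(1)]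
  have "log_det_div (1\<^sub>m n) Y = (\<Sum>i<n. \<Sum>j<n. overlap U V i j * log_jensen 1 (d j))"
    using V log_det_div_one o by simp
  also have "\<dots> \<le> (\<Sum>i<n. \<Sum>j<n. overlap U V i j *
      ((1 + l) * log_jensen 1 (z i) + (1 + 1 / l) * log_jensen (z i) (d j)))"
    using U V l by (intro sum_mono mult_left_mono log_jensen_triangle) auto
  also have "\<dots> = (1 + l) * (\<Sum>i<n. \<Sum>j<n. overlap U V i j * log_jensen 1 (z i)) +
      (1 + 1 / l) * (\<Sum>i<n. \<Sum>j<n. overlap U V i j * log_jensen (z i) (d j))"
    unfolding sum_distrib_left sum.distrib[symmetric]
    by (intro sum.cong refl) (simp only: distrib_left mult_ac)
  also have "\<dots> \<le> (1 + l) * log_det_div (1\<^sub>m n) Z + (1 + 1 / l) * log_det_div Z Y"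
    using l log_det_div_ge_overlap[OF U(1) V(1) U(3) V(3)] U V
    by (intro add_mono mult_left_mono) (auto simp: o log_det_div_one)
  finally show ?thesis .
qed

text \<open>Congruence adds \<open>2 * log_det S\<close> to each log-determinant, which cancels
  between the mean and the average.\<close>

lemma log_det_div_congruence:
  assumes S: "S \<in> carrier_mat n n" "det S \<noteq> 0" and A: "pd_mat n A" and B: "pd_mat n B"
  shows "log_det_div (S * A * S) (S * B * S) = log_det_div A B"
proof -
  note c = S(1) pd_carrier[OF A] pd_carrier[OF B]
  have M: "pd_mat n (mat_mean A B)" using pd_mean[OF A] B by (simp add: pd_mat_def)
  have ld: "log_det (S * C * S) = 2 * log_det S + log_det C" if "pd_mat n C" for C
    using S that pd_carrier[OF that]
    by (simp add: log_det_mult[of _ n] mult_carrier_mat[of _ n n] det_mult[of _ n] pd_mat_def)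
  have "mat_mean (S * A * S) (S * B * S) = S * mat_mean A B * S"
    unfolding mat_mean_def using c
    by (simp add: mult_add_distrib_mat[of _ n n _ n] add_mult_distrib_mat[of _ n n _ _ n]
        mult_smult_distrib[of _ n n _ n] mult_smult_assoc_mat[of _ n n _ n] mult_carrier_mat[of _ n n])
  then show ?thesis by (simp add: log_det_div_def ld A B M field_simps)
qed

lemma log_det_div_triangle:
  assumes X: "pd_mat n X" and Y: "pd_mat n Y" and Z: "pd_mat n Z" and l: "0 < l"
  shows "log_det_div X Y \<le> (1 + l) * log_det_div X Z + (1 + 1 / l) * log_det_div Z Y"
proof -
  obtain U x where U: "unitary_mat n U" "X = spec n U x" "\<And>i. i < n \<Longrightarrow> 0 < x i"
    using pd_spectral[OF X] by blast
  \<comment> \<open>\<open>S\<close> is the inverse square root of \<open>X\<close>, so congruence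
    by it moves \<open>X\<close> to the identity.\<close>
  define S where "S = spec n U (\<lambda>i. 1 / sqrt (x i))"
  have S: "pd_mat n S" unfolding S_def using U by (intro pd_spec) auto
  have S': "S \<in> carrier_mat n n" "det S \<noteq> 0" "adj S = S"
    using S U by (auto simp: pd_mat_def S_def adj_spec psd_carrier)
  have "S * X * S = spec n U (\<lambda>_. 1)"
    unfolding S_def U(2) spec_mult[OF U(1)] by (rule spec_cong) (use U(3) in \<open>force simp: field_simps\<close>)
  then have SX: "S * X * S = 1\<^sub>m n" by (simp add: spec_one[OF U(1)])
  have pd: "pd_mat n (S * C * S)" if "pd_mat n C" for C
    using that psd_congruence[of n C S n] S' pd_carrier[OF that]
    by (simp add: pd_mat_def det_mult[of _ n] mult_carrier_mat[of _ n n])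
  show ?thesis
    using log_det_div_triangle_one[OF pd[OF Y] pd[OF Z] l]
    by (simp add: SX[symmetric] log_det_div_congruence[OF S'(1,2)] X Y Z)
qed


subsection \<open>The triangle inequality for the transmission distance\<close>

text \<open>Natural logarithms keep derivatives free of constants; base 2 enters only through a
  division by \<open>ln 2\<close>. The value at 0 is 0, which is also the limit from the
  right.\<close>

definition xlnx :: "real \<Rightarrow> real" where
  "xlnx x = x * ln x"

lemma entropy_spec:
  assumes U: "unitary_mat n U"
  shows "von_neumann_entropy (spec n U a) = - (\<Sum>i<n. xlnx (a i)) / ln 2"
proof -
  have "hermitian_fun (log 2) (spec n U a) = spec n U (\<lambda>i. log 2 (a i))"
    using hermitian_fun_eq[OF U, of "spec n U a" a "log 2"] by (simp add: spec_def)
  then show ?thesis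
    by (simp add: von_neumann_entropy_def spec_mult[OF U] mat_trace_spec[OF U] xlnx_def log_def
        sum_divide_distrib)
qed

lemma QJSD_spec:
  assumes "unitary_mat n U" "unitary_mat n V" "unitary_mat n W"
    and "mat_mean (spec n U a) (spec n V b) = spec n W c"
  shows "QJSD (spec n U a) (spec n V b) =
    (((\<Sum>i<n. xlnx (a i)) + (\<Sum>i<n. xlnx (b i))) / 2 - (\<Sum>i<n. xlnx (c i))) / ln 2"
  using assms(4) unfolding QJSD_def mat_mean_def
  by (simp add: entropy_spec[OF assms(1)] entropy_spec[OF assms(2)] entropy_spec[OF assms(3)] field_simps)

text \<open>Linearity of the trace. It makes the terms of \<open>shift_jensen\<close> that grow with
  t cancel.\<close>

lemma sum_eigenvalues_mean:
  assumes "unitary_mat n U" "unitary_mat n V" "unitary_mat n W"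
    and "mat_mean (spec n U a) (spec n V b) = spec n W c"
  shows "(\<Sum>i<n. c i) = ((\<Sum>i<n. a i) + (\<Sum>i<n. b i)) / 2"
proof -
  have "complex_of_real (\<Sum>i<n. c i) = mat_trace (mat_mean (spec n U a) (spec n V b))"
    unfolding assms(4) by (simp add: mat_trace_spec assms)
  also have "\<dots> = of_real (((\<Sum>i<n. a i) + (\<Sum>i<n. b i)) / 2)"
    using assms(1-3) by (simp add: mat_mean_def mat_trace_smult[of _ n] mat_trace_add[of _ n] mat_trace_spec)
  finally show ?thesis using of_real_eq_iff by blast
qed

text \<open>The eigenvalues enter through \<open>\<Sum> (x\<^sub>i + t) ln (x\<^sub>i + t)\<close>, so that the derivative in \<open>t\<close>
  is minus the log-determinant divergence of the matrices shifted by \<open>t\<close>.\<close>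

definition shift_jensen :: "nat \<Rightarrow> (nat \<Rightarrow> real) \<Rightarrow> (nat \<Rightarrow> real) \<Rightarrow> (nat \<Rightarrow> real) \<Rightarrow> real \<Rightarrow> real" where
  "shift_jensen n a b c t =
    ((\<Sum>i<n. xlnx (a i + t)) + (\<Sum>i<n. xlnx (b i + t))) / 2 - (\<Sum>i<n. xlnx (c i + t))"

lemma has_real_derivative_sum_xlnx:
  assumes "\<And>i. i < n \<Longrightarrow> 0 \<le> a i" "0 < t"
  shows "((\<lambda>t. \<Sum>i<n. xlnx (a i + t)) has_real_derivative (\<Sum>i<n. ln (a i + t)) + real n) (at t)"
proof -
  have "((\<lambda>t. xlnx (a i + t)) has_real_derivative ln (a i + t) + 1) (at t)" if "i < n" for i
    using assms(1)[OF that] assms(2) unfolding xlnx_def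
    by (auto intro!: derivative_eq_intros simp: add_nonneg_pos)
  then have "((\<lambda>t. \<Sum>i<n. xlnx (a i + t)) has_real_derivative (\<Sum>i<n. ln (a i + t) + 1)) (at t)"
    by (intro DERIV_sum) auto
  then show ?thesis by (simp add: sum.distrib)
qed

lemma has_real_derivative_shift_jensen:
  assumes "\<And>i. i < n \<Longrightarrow> 0 \<le> a i" "\<And>i. i < n \<Longrightarrow> 0 \<le> b i" "\<And>i. i < n \<Longrightarrow> 0 \<le> c i" "0 < t"
  shows "(shift_jensen n a b c has_real_derivative
    ((\<Sum>i<n. ln (a i + t)) + (\<Sum>i<n. ln (b i + t))) / 2 - (\<Sum>i<n. ln (c i + t))) (at t)"
proof -
  have "((\<lambda>t. ((\<Sum>i<n. xlnx (a i + t)) + (\<Sum>i<n. xlnx (b i + t))) / 2 - (\<Sum>i<n. xlnx (c i + t)))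
    has_real_derivative ((\<Sum>i<n. ln (a i + t)) + real n + ((\<Sum>i<n. ln (b i + t)) + real n)) / 2
      - ((\<Sum>i<n. ln (c i + t)) + real n)) (at t)"
    by (intro DERIV_diff DERIV_add DERIV_cdivide has_real_derivative_sum_xlnx assms)
  then show ?thesis
    unfolding shift_jensen_def[abs_def] by (rule DERIV_cong) (simp add: field_simps)
qed

lemma tendsto_xlnx_shift_0:
  assumes "0 \<le> x"
  shows "((\<lambda>t. xlnx (x + t)) \<longlongrightarrow> xlnx (x + 0)) (at_right 0)"
proof (cases "x = 0")
  case True
  have "((\<lambda>t::real. t * ln t) \<longlongrightarrow> 0) (at_right 0)" by real_asymp
  then show ?thesis using True by (simp add: xlnx_def)
next
  case False
  then show ?thesis using assms unfolding xlnx_def by (intro tendsto_intros) auto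
qed

lemma tendsto_shift_jensen_0:
  assumes "\<And>i. i < n \<Longrightarrow> 0 \<le> a i" "\<And>i. i < n \<Longrightarrow> 0 \<le> b i" "\<And>i. i < n \<Longrightarrow> 0 \<le> c i"
  shows "(shift_jensen n a b c \<longlongrightarrow> shift_jensen n a b c 0) (at_right 0)"
  unfolding shift_jensen_def[abs_def] 
  by (intro tendsto_intros tendsto_xlnx_shift_0) (use assms in auto)

lemma tendsto_shift_jensen_at_top:
  assumes sum: "(\<Sum>i<n. c i) = ((\<Sum>i<n. a i) + (\<Sum>i<n. b i)) / 2"
  shows "(shift_jensen n a b c \<longlongrightarrow> 0) at_top"
proof -
  \<comment> \<open>\<open>r x t\<close> is the remainder of the expansion of (x + t) ln (x + t) for
    large t. The subtracted terms depend on the eigenvalues only through their number and their sum,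
    so they cancel.\<close>
  define r where "r x t = xlnx (x + t) - (t * ln t + x * (ln t + 1))" for x t
  have r: "(r x \<longlongrightarrow> 0) at_top" for x
    unfolding r_def[abs_def] xlnx_def by real_asymp
  have x: "(\<Sum>i<n. xlnx (f i + t)) = (\<Sum>i<n. r (f i) t) + real n * (t * ln t) + (\<Sum>i<n. f i) * (ln t + 1)" for f t
    by (simp add: r_def sum.distrib sum_subtractf sum_distrib_right)
  have "shift_jensen n a b c = (\<lambda>t. ((\<Sum>i<n. r (a i) t) + (\<Sum>i<n. r (b i) t)) / 2 - (\<Sum>i<n. r (c i) t))"
    unfolding shift_jensen_def x sum by (simp add: fun_eq_iff field_simps)
  moreover have "((\<lambda>t. ((\<Sum>i<n. r (a i) t) + (\<Sum>i<n. r (b i) t)) / 2 - (\<Sum>i<n. r (c i) t))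
      \<longlongrightarrow> ((\<Sum>i<n. 0) + (\<Sum>i<n. 0)) / 2 - (\<Sum>i<n. 0)) at_top"
    by (intro tendsto_intros r) auto
  ultimately show ?thesis by simp
qed

text \<open>Shifting both matrices by t shifts their mean by t, hence also its eigenvalues.\<close>

lemma log_det_div_shift:
  assumes U: "unitary_mat n U" and V: "unitary_mat n V" and W: "unitary_mat n W"
    and c: "mat_mean (spec n U a) (spec n V b) = spec n W c"
    and pos: "\<And>i. i < n \<Longrightarrow> 0 \<le> a i" "\<And>i. i < n \<Longrightarrow> 0 \<le> b i" "\<And>i. i < n \<Longrightarrow> 0 \<le> c i" "0 < t"
  shows "log_det_div (spec n U a + of_real t \<cdot>\<^sub>m 1\<^sub>m n) (spec n V b + of_real t \<cdot>\<^sub>m 1\<^sub>m n)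
    = (\<Sum>i<n. ln (c i + t)) - ((\<Sum>i<n. ln (a i + t)) + (\<Sum>i<n. ln (b i + t))) / 2"
proof -
  have "mat_mean (spec n U a + of_real t \<cdot>\<^sub>m 1\<^sub>m n) (spec n V b + of_real t \<cdot>\<^sub>m 1\<^sub>m n)
    = mat_mean (spec n U a) (spec n V b) + of_real t \<cdot>\<^sub>m 1\<^sub>m n"
    using carrier_matD[OF spec_carrier[OF U]] carrier_matD[OF spec_carrier[OF V]]
    unfolding mat_mean_def by (intro eq_matI) (auto simp: field_simps)
  also have "\<dots> = spec n W (\<lambda>i. c i + t)" unfolding c spec_shift[OF W] ..
  finally show ?thesis
    using pos by (simp add: log_det_div_def log_det_spec U V W spec_shift[symmetric] add_nonneg_pos)
qed

lemma has_real_derivative_shift_jensen_log_det_div: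
  assumes U: "unitary_mat n U" and V: "unitary_mat n V" and W: "unitary_mat n W"
    and c: "mat_mean (spec n U a) (spec n V b) = spec n W c"
    and pos: "\<And>i. i < n \<Longrightarrow> 0 \<le> a i" "\<And>i. i < n \<Longrightarrow> 0 \<le> b i" "\<And>i. i < n \<Longrightarrow> 0 \<le> c i" "0 < t"
  shows "(shift_jensen n a b c has_real_derivative
    - log_det_div (spec n U a + of_real t \<cdot>\<^sub>m 1\<^sub>m n) (spec n V b + of_real t \<cdot>\<^sub>m 1\<^sub>m n)) (at t)"
proof -
  have "log_det_div (spec n U a + of_real t \<cdot>\<^sub>m 1\<^sub>m n) (spec n V b + of_real t \<cdot>\<^sub>m 1\<^sub>m n)
    = (\<Sum>i<n. ln (c i + t)) - ((\<Sum>i<n. ln (a i + t)) + (\<Sum>i<n. ln (b i + t))) / 2"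
    by (rule log_det_div_shift[OF U V W c]) (use pos in auto)
  then show ?thesis
    using has_real_derivative_shift_jensen[of n a b c t] pos by simp
qed

text \<open>The inequality is linear in the divergences, so it passes from
  \<open>log_det_div\<close> at each shift t > 0 to \<open>QJSD\<close> by
  \<open>nonneg_if_deriv_nonpos\<close>.\<close>

lemma QJSD_triangle_weighted:
  assumes X: "psd_mat n X" and Y: "psd_mat n Y" and Z: "psd_mat n Z" and l: "0 < l"
  shows "QJSD X Y \<le> (1 + l) * QJSD X Z + (1 + 1 / l) * QJSD Z Y"
proof -
  obtain U x where U: "unitary_mat n U" "X = spec n U x" "\<And>i. i < n \<Longrightarrow> 0 \<le> x i"
    using psd_spectral[OF X] by blast
  obtain V y where V: "unitary_mat n V" "Y = spec n V y" "\<And>i. i < n \<Longrightarrow> 0 \<le> y i"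
    using psd_spectral[OF Y] by blast
  obtain W z where W: "unitary_mat n W" "Z = spec n W z" "\<And>i. i < n \<Longrightarrow> 0 \<le> z i"
    using psd_spectral[OF Z] by blast
  obtain P p where P: "unitary_mat n P" "mat_mean X Y = spec n P p" "\<And>i. i < n \<Longrightarrow> 0 \<le> p i"
    using psd_spectral[OF psd_mean[OF X Y]] by blast
  obtain Q q where Q: "unitary_mat n Q" "mat_mean X Z = spec n Q q" "\<And>i. i < n \<Longrightarrow> 0 \<le> q i"
    using psd_spectral[OF psd_mean[OF X Z]] by blast
  obtain R r where R: "unitary_mat n R" "mat_mean Z Y = spec n R r" "\<And>i. i < n \<Longrightarrow> 0 \<le> r i"
    using psd_spectral[OF psd_mean[OF Z Y]] by blast
  note mean = P(2)[unfolded U(2) V(2)] Q(2)[unfolded U(2) W(2)] R(2)[unfolded W(2) V(2)]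
  \<comment> \<open>At t = 0 this is \<open>ln 2\<close> times the slack of the claim, and its
    derivative is minus the slack for the shifted matrices.\<close>
  define L where "L t = (1 + l) * shift_jensen n x z q t + (1 + 1 / l) * shift_jensen n z y r t
    - shift_jensen n x y p t" for t
  \<comment> \<open>The shift makes semidefinite matrices definite, as
    \<open>log_det_div_triangle\<close> demands.\<close>
  have pd: "pd_mat n (A + of_real t \<cdot>\<^sub>m 1\<^sub>m n)" if "psd_mat n A" "0 < t" for A t
  proof -
    obtain U d where U: "unitary_mat n U" "A = spec n U d" "\<And>i. i < n \<Longrightarrow> 0 \<le> d i"
      using psd_spectral[OF \<open>psd_mat n A\<close>] by blast
    show ?thesis unfolding U(2) spec_shift[OF U(1), symmetric] using U that by (intro pd_spec add_nonneg_pos) auto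
  qed
  have "0 \<le> L 0"
  proof (rule nonneg_if_deriv_nonpos)
    fix t :: real assume t: "0 < t"
    define J where "J = of_real t \<cdot>\<^sub>m (1\<^sub>m n :: complex mat)"
    show "(L has_real_derivative (1 + l) * (- log_det_div (X + J) (Z + J))
      + (1 + 1 / l) * (- log_det_div (Z + J) (Y + J)) - (- log_det_div (X + J) (Y + J))) (at t)"
      unfolding L_def[abs_def] J_def U(2) V(2) W(2)
      by (intro DERIV_diff DERIV_add DERIV_cmult
          has_real_derivative_shift_jensen_log_det_div[OF U(1) V(1) P(1) mean(1)]
          has_real_derivative_shift_jensen_log_det_div[OF U(1) W(1) Q(1) mean(2)]
          has_real_derivative_shift_jensen_log_det_div[OF W(1) V(1) R(1) mean(3)]
          U V W P Q R t)
    show "(1 + l) * (- log_det_div (X + J) (Z + J))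
      + (1 + 1 / l) * (- log_det_div (Z + J) (Y + J)) - (- log_det_div (X + J) (Y + J)) \<le> 0"
      using log_det_div_triangle[OF pd[OF X t] pd[OF Y t] pd[OF Z t] l] by (simp add: J_def)
  next
    show "(L \<longlongrightarrow> L 0) (at_right 0)"
      unfolding L_def[abs_def] by (intro tendsto_intros tendsto_shift_jensen_0 U V W P Q R)
    have "(L \<longlongrightarrow> (1 + l) * 0 + (1 + 1 / l) * 0 - 0) at_top"
      unfolding L_def[abs_def]
      by (intro tendsto_intros tendsto_shift_jensen_at_top)
        (rule sum_eigenvalues_mean[OF U(1) W(1) Q(1) mean(2)] sum_eigenvalues_mean[OF W(1) V(1) R(1) mean(3)]
          sum_eigenvalues_mean[OF U(1) V(1) P(1) mean(1)])+
    then show "(L \<longlongrightarrow> 0) at_top" by simp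
  qed
  then have "0 \<le> L 0 / ln 2" by simp
  also have "L 0 / ln 2 = (1 + l) * QJSD X Z + (1 + 1 / l) * QJSD Z Y - QJSD X Y"
    unfolding U(2) V(2) W(2) QJSD_spec[OF U(1) V(1) P(1) mean(1)] QJSD_spec[OF U(1) W(1) Q(1) mean(2)]
      QJSD_spec[OF W(1) V(1) R(1) mean(3)] L_def shift_jensen_def
    by (simp add: diff_divide_distrib add_divide_distrib algebra_simps)
  finally show ?thesis by simp
qed

section \<open>From the weighted inequality to the metric property\<close>

lemma QJSD_self:
  assumes "psd_mat n X"
  shows "QJSD X X = 0"
proof -
  have "(1/2) \<cdot>\<^sub>m (X + X) = X" by (intro eq_matI) auto
  then show ?thesis by (simp add: QJSD_def)
qed

lemma QJSD_comm:
  assumes "psd_mat n X" "psd_mat n Y"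
  shows "QJSD X Y = QJSD Y X"
  using mat_mean_comm[OF psd_carrier[OF assms(1)] psd_carrier[OF assms(2)]]
  by (simp add: QJSD_def mat_mean_def)

text \<open>The weighted inequality from \<open>X\<close> back to \<open>X\<close> through
  \<open>Y\<close> with l = 1 bounds 0 by four times the divergence.\<close>

lemma QJSD_nonneg:
  assumes "psd_mat n X" "psd_mat n Y"
  shows "0 \<le> QJSD X Y"
  using QJSD_triangle_weighted[OF assms(1,1,2), of 1] QJSD_comm[OF assms] QJSD_self[OF assms(1)] by simp

text \<open>The infimum of the right-hand side over l is the square of a + b. It is attained at l =
  b / a if both are positive; if one vanishes it may only be approached, hence the slack
  \<open>e\<close>.\<close>

lemma le_power2_if_weighted:
  fixes a b q :: real
  assumes ab: "0 \<le> a" "0 \<le> b" and w: "\<And>l. 0 < l \<Longrightarrow> q \<le> (1 + l) * a\<^sup>2 + (1 + 1 / l) * b\<^sup>2"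
  shows "q \<le> (a + b)\<^sup>2"
proof -
  have "q \<le> (a + b)\<^sup>2 + e" if e: "0 < e" for e
  proof -
    have frac: "e / (x + 1) * x \<le> e" if "0 \<le> x" for x
      using e that by (simp add: pos_divide_le_eq distrib_left)
    show ?thesis
    proof (cases "a = 0")
      case True
      \<comment> \<open>Here l is large, so that the weight on b exceeds 1 by little; adding 1 to
        the square keeps l positive also for b = 0.\<close>
      have "q \<le> b\<^sup>2 + e / (b\<^sup>2 + 1) * b\<^sup>2" 
        using w[of "(b\<^sup>2 + 1) / e"] e True by (simp add: add_nonneg_pos distrib_right)
      also have "e / (b\<^sup>2 + 1) * b\<^sup>2 \<le> e" by (rule frac) simp
      finally show ?thesis using True by simp
    next
      case False
      show ?thesis
      proof (cases "b = 0")
        case True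
        have "q \<le> a\<^sup>2 + e / (a\<^sup>2 + 1) * a\<^sup>2" 
          using w[of "e / (a\<^sup>2 + 1)"] e True by (simp add: add_nonneg_pos distrib_right)
        also have "e / (a\<^sup>2 + 1) * a\<^sup>2 \<le> e" by (rule frac) simp
        finally show ?thesis using True by simp
      next
        case False
        then have p: "0 < a" "0 < b" using \<open>a \<noteq> 0\<close> ab by auto
        have "q \<le> (1 + b / a) * a\<^sup>2 + (1 + 1 / (b / a)) * b\<^sup>2" using p by (intro w) simp
        also have "\<dots> = (a + b)\<^sup>2" using p by (simp add: power2_eq_square field_simps)
        finally show ?thesis using e by simp
      qed
    qed
  qed
  then show ?thesis by (rule field_le_epsilon)
qed

theorem transmission_dist_triangle:
  assumes "psd_mat n X" "psd_mat n Y" "psd_mat n Z"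
  shows "transmission_dist X Y \<le> transmission_dist X Z + transmission_dist Z Y"
proof -
  note nn = QJSD_nonneg[OF assms(1,3)] QJSD_nonneg[OF assms(3,2)]
  have "QJSD X Y \<le> (sqrt (QJSD X Z) + sqrt (QJSD Z Y))\<^sup>2"
    by (rule le_power2_if_weighted) (use nn QJSD_triangle_weighted[OF assms] in auto)
  then show ?thesis unfolding transmission_dist_def using nn by (intro real_le_lsqrt) auto
qed


subsection \<open>Complete positivity\<close>

lemma sum_lessThan_mult:
  fixes f :: "nat \<Rightarrow> 'a::comm_monoid_add"
  shows "(\<Sum>r<n * k. f r) = (\<Sum>i<n. \<Sum>a<k. f (i * k + a))"
proof -
  have "(\<Sum>r\<in>{i * k..<i * k + k}. f r) = (\<Sum>a<k. f (i * k + a))" for i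
    using sum.shift_bounds_nat_ivl[of f 0 "i * k" k] by (simp add: atLeast0LessThan add.commute)
  then show ?thesis by (simp add: sum.nat_group[symmetric])
qed

lemma mult_add_less:
  fixes i a :: nat
  assumes "i < n" "a < k"
  shows "i * k + a < n * k"
proof -
  have "i * k + a < Suc i * k" using assms(2) by simp
  also have "\<dots> \<le> n * k" using assms(1) by (intro mult_le_mono1) simp
  finally show ?thesis .
qed

lemma tensor_id_carrier [simp]: "tensor_id N K E X \<in> carrier_mat (N * K) (N * K)"
  by (simp add: tensor_id_def)

lemma tensor_id_index:
  assumes "i < N" "j < N" "a < K" "b < K"
  shows "tensor_id N K E X $$ (i * K + a, j * K + b)
    = E (mat N N (\<lambda>(i, j). X $$ (i * K + a, j * K + b))) $$ (i, j)"
  using assms mult_add_less[of i N a K] mult_add_less[of j N b K] by (simp add: tensor_id_def)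

text \<open>Associativity of the tensor product. In the chosen index order
  \<open>(i * K + a) * m + s = i * (K * m) + (a * m + s)\<close>, so no basis has to be
  permuted.\<close>

lemma tensor_id_tensor_id: "tensor_id (N * K) m (tensor_id N K E) X = tensor_id N (K * m) E X"
proof (rule eq_matI)
  fix r c assume "r < dim_row (tensor_id N (K * m) E X)" "c < dim_col (tensor_id N (K * m) E X)"
  then have rc: "r < N * (K * m)" "c < N * (K * m)" by (simp_all add: tensor_id_def)
  then have K: "0 < K" "0 < m" by (auto intro: Nat.gr0I)
  have rc': "r < N * K * m" "c < N * K * m" using rc by (simp_all add: mult.assoc)
  have d: "r div m < N * K" "c div m < N * K" using rc' by (auto simp: less_mult_imp_div_less)
  have x: "x div (K * m) = x div m div K" "x mod (K * m) = (x div m mod K) * m + x mod m" for x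
    using div_mult2_eq[of x m K] mod_mult2_eq[of x m K] by (simp_all add: mult.commute)
  have "mat N N (\<lambda>(i, j). mat (N * K) (N * K) (\<lambda>(i, j). X $$ (i * m + r mod m, j * m + c mod m))
      $$ (i * K + r div m mod K, j * K + c div m mod K))
    = mat N N (\<lambda>(i, j). X $$ (i * (K * m) + r mod (K * m), j * (K * m) + c mod (K * m)))"
    using K by (intro eq_matI) (auto simp: mult_add_less x distrib_right mult.assoc add.assoc)
  then show "tensor_id (N * K) m (tensor_id N K E) X $$ (r, c) = tensor_id N (K * m) E X $$ (r, c)"
    using rc rc' d by (simp add: tensor_id_def x(1))
qed (simp_all add: tensor_id_def mult.assoc)

text \<open>Linearity and trace preservation are inherited block by block. Complete positivity is
  inherited since a further ancilla merges with the first one by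
  \<open>tensor_id_tensor_id\<close>.\<close>

lemma quantum_operation_tensor_id:
  assumes "quantum_operation N E"
  shows "quantum_operation (N * K) (tensor_id N K E)"
proof -
  have lin: "linear_mat_map N E" and cp: "completely_positive N E" and tp: "trace_preserving N E"
    using assms by (auto simp: quantum_operation_def)
  \<comment> \<open>The N x N block of \<open>X\<close> at fixed ancilla indices a and b, to which
    \<open>E\<close> is applied.\<close>
  define blk where "blk X a b = mat N N (\<lambda>(i, j). X $$ (i * K + a, j * K + b))" for X :: "complex mat" and a b
  have blk: "blk X a b \<in> carrier_mat N N" for X a b by (simp add: blk_def)
  have E: "E (blk X a b) \<in> carrier_mat N N" for X a b using lin blk by (simp add: linear_mat_map_def)
  have t: "tensor_id N K E X $$ (r, c) = E (blk X (r mod K) (c mod K)) $$ (r div K, c div K)"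
    if "r < N * K" "c < N * K" for X r c
    using that by (simp add: tensor_id_def blk_def)
  have d: "r div K < N" "0 < K" "r mod K < K" if "r < N * K" for r
  proof -
    show "0 < K" using that by (auto intro: Nat.gr0I)
    then show "r div K < N" "r mod K < K" using that by (auto simp: less_mult_imp_div_less)
  qed
  have "linear_mat_map (N * K) (tensor_id N K E)"
    unfolding linear_mat_map_def
  proof (intro conjI ballI allI)
    fix A B :: "complex mat" and z assume A: "A \<in> carrier_mat (N * K) (N * K)"
    show "tensor_id N K E A \<in> carrier_mat (N * K) (N * K)" by simp
    have *: "blk (z \<cdot>\<^sub>m A) a b = z \<cdot>\<^sub>m blk A a b" if "a < K" "b < K" for a b
      using A that by (intro eq_matI) (auto simp: blk_def mult_add_less)
    have **: "E (blk (z \<cdot>\<^sub>m A) a b) = z \<cdot>\<^sub>m E (blk A a b)" if "a < K" "b < K" for a b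
      unfolding *[OF that] using lin blk unfolding linear_mat_map_def by blast
    show "tensor_id N K E (z \<cdot>\<^sub>m A) = z \<cdot>\<^sub>m tensor_id N K E A"
    proof (rule eq_matI)
      fix r c assume "r < dim_row (z \<cdot>\<^sub>m tensor_id N K E A)" "c < dim_col (z \<cdot>\<^sub>m tensor_id N K E A)"
      then have rc: "r < N * K" "c < N * K" by (simp_all add: tensor_id_def)
      then show "tensor_id N K E (z \<cdot>\<^sub>m A) $$ (r, c) = (z \<cdot>\<^sub>m tensor_id N K E A) $$ (r, c)"
        using d[OF rc(1)] d[OF rc(2)]
        by (simp add: t ** carrier_matD[OF tensor_id_carrier] carrier_matD[OF E])
    qed (simp_all add: tensor_id_def)
    assume B: "B \<in> carrier_mat (N * K) (N * K)"
    have *: "blk (A + B) a b = blk A a b + blk B a b" if "a < K" "b < K" for a b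
      using A B that by (intro eq_matI) (auto simp: blk_def mult_add_less)
    have **: "E (blk (A + B) a b) = E (blk A a b) + E (blk B a b)" if "a < K" "b < K" for a b
      unfolding *[OF that] using lin blk unfolding linear_mat_map_def by blast
    show "tensor_id N K E (A + B) = tensor_id N K E A + tensor_id N K E B"
    proof (rule eq_matI)
      fix r c assume "r < dim_row (tensor_id N K E A + tensor_id N K E B)"
        "c < dim_col (tensor_id N K E A + tensor_id N K E B)"
      then have rc: "r < N * K" "c < N * K" by (simp_all add: tensor_id_def)
      then show "tensor_id N K E (A + B) $$ (r, c) = (tensor_id N K E A + tensor_id N K E B) $$ (r, c)"
        using d[OF rc(1)] d[OF rc(2)]
        by (simp add: t ** carrier_matD[OF tensor_id_carrier] carrier_matD[OF E])
    qed (simp_all add: tensor_id_def)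
  qed
  moreover have "completely_positive (N * K) (tensor_id N K E)"
    using cp by (simp add: completely_positive_def tensor_id_tensor_id mult.assoc)
  moreover have "trace_preserving (N * K) (tensor_id N K E)"
    unfolding trace_preserving_def
  proof
    fix X :: "complex mat" assume X: "X \<in> carrier_mat (N * K) (N * K)"
    have "mat_trace (tensor_id N K E X) = (\<Sum>i<N. \<Sum>a<K. E (blk X a a) $$ (i, i))"
      by (simp add: mat_trace_def carrier_matD[OF tensor_id_carrier] sum_lessThan_mult tensor_id_index blk_def)
    also have "\<dots> = (\<Sum>a<K. mat_trace (E (blk X a a)))"
      by (subst sum.swap) (simp add: mat_trace_def carrier_matD[OF E])
    also have "\<dots> = (\<Sum>a<K. mat_trace (blk X a a))"
      using tp blk by (simp add: trace_preserving_def)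
    also have "\<dots> = (\<Sum>a<K. \<Sum>i<N. X $$ (i * K + a, i * K + a))"
      by (simp add: mat_trace_def blk_def)
    also have "\<dots> = mat_trace X"
      using X by (subst sum.swap) (simp add: mat_trace_def sum_lessThan_mult)
    finally show "mat_trace (tensor_id N K E X) = mat_trace X" .
  qed
  ultimately show ?thesis by (simp add: quantum_operation_def)
qed

lemma tensor_id_one: "X \<in> carrier_mat n n \<Longrightarrow> \<Phi> X \<in> carrier_mat n n \<Longrightarrow> tensor_id n 1 \<Phi> X = \<Phi> X"
proof (rule eq_matI)
  assume X: "X \<in> carrier_mat n n" "\<Phi> X \<in> carrier_mat n n"
  have "mat n n (\<lambda>(i, j). X $$ (i, j)) = X" using X by (intro eq_matI) auto
  then show "tensor_id n 1 \<Phi> X $$ (i, j) = \<Phi> X $$ (i, j)"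
    if "i < dim_row (\<Phi> X)" "j < dim_col (\<Phi> X)" for i j
    using that X by (simp add: tensor_id_def)
qed (auto simp: tensor_id_def)

lemma quantum_operation_carrier:
  "quantum_operation n \<Phi> \<Longrightarrow> A \<in> carrier_mat n n \<Longrightarrow> \<Phi> A \<in> carrier_mat n n"
  by (simp add: quantum_operation_def linear_mat_map_def)

text \<open>Complete positivity with a one-dimensional ancilla.\<close>

lemma quantum_operation_psd:
  assumes "quantum_operation n \<Phi>" "psd_mat n A"
  shows "psd_mat n (\<Phi> A)"
proof -
  have "psd_mat n (tensor_id n 1 \<Phi> A)"
    using assms by (auto simp: quantum_operation_def completely_positive_def dest!: spec[of _ 1])
  then show ?thesis
    using tensor_id_one[of A n \<Phi>] quantum_operation_carrier[OF assms(1)] psd_carrier[OF assms(2)] by simp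
qed

text \<open>Stack the \<open>B s\<close> into a column \<open>M\<close>:
  \<open>M * A * adj M\<close> is positive semidefinite with blocks
  \<open>B s * A * adj (B t)\<close>. Complete positivity applies the map to each block and keeps
  positivity, and compression by the row \<open>L\<close> of the \<open>C s\<close> gives a matrix
  whose trace is the double sum.\<close>

lemma completely_positive_sum_nonneg:
  fixes B C :: "nat \<Rightarrow> complex mat"
  assumes \<Phi>: "completely_positive n \<Phi>" and A: "psd_mat n A"
    and lin: "\<And>X. X \<in> carrier_mat n n \<Longrightarrow> \<Phi> X \<in> carrier_mat n n"
    and B: "\<And>s. s < m \<Longrightarrow> B s \<in> carrier_mat n n" and C: "\<And>s. s < m \<Longrightarrow> C s \<in> carrier_mat n n"
  shows "0 \<le> Re (\<Sum>s<m. \<Sum>t<m. mat_trace (C s * \<Phi> (B s * A * adj (B t)) * adj (C t)))"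
proof -
  note a = psd_carrier[OF A]
  \<comment> \<open>The index is \<open>i * m + s\<close>, with the block number s in the place of
    the ancilla, as \<open>tensor_id\<close> expects.\<close>
  define M where "M = mat (n * m) n (\<lambda>(r, j). B (r mod m) $$ (r div m, j))"
  define L where "L = mat n (n * m) (\<lambda>(k, r). C (r mod m) $$ (k, r div m))"
  have M: "M \<in> carrier_mat (n * m) n" and L: "L \<in> carrier_mat n (n * m)" by (simp_all add: M_def L_def)
  define P where "P = tensor_id n m \<Phi> (M * A * adj M)"
  have P: "psd_mat (n * m) P"
    using \<Phi> psd_congruence[OF A M] by (simp add: P_def completely_positive_def)
  note p = psd_carrier[OF P]
  have BA: "B s * A * adj (B t) \<in> carrier_mat n n" if "s < m" "t < m" for s t
    using B a that by (auto intro!: mult_carrier_mat[of _ n n] mat_adjoint_carrier)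
  have MLi: "M $$ (i * m + s, j) = B s $$ (i, j)" "L $$ (j, i * m + s) = C s $$ (j, i)"
    if "i < n" "s < m" "j < n" for i j s
    using that by (simp_all add: M_def L_def mult_add_less)
  have MAM: "(M * A * adj M) $$ (i * m + s, j * m + t) = (B s * A * adj (B t)) $$ (i, j)"
    if "i < n" "j < n" "s < m" "t < m" for i j s t
  proof -
    have r: "i * m + s < n * m" "j * m + t < n * m" using that by (auto simp: mult_add_less)
    have "(M * A * adj M) $$ (i * m + s, j * m + t) =
        (\<Sum>l<n. (\<Sum>k<n. M $$ (i * m + s, k) * A $$ (k, l)) * cnj (M $$ (j * m + t, l)))"
      using M a r by (simp add: scalar_prod_def atLeast0LessThan)
    also have "\<dots> = (\<Sum>l<n. (\<Sum>k<n. B s $$ (i, k) * A $$ (k, l)) * cnj (B t $$ (j, l)))"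
      using that by (simp add: MLi)
    also have "\<dots> = (B s * A * adj (B t)) $$ (i, j)"
      using B[OF that(3)] B[OF that(4)] a that by (simp add: scalar_prod_def atLeast0LessThan)
    finally show ?thesis .
  qed
  have Pi: "P $$ (i * m + s, j * m + t) = \<Phi> (B s * A * adj (B t)) $$ (i, j)"
    if "i < n" "j < n" "s < m" "t < m" for i j s t
  proof -
    have "mat n n (\<lambda>(i, j). (M * A * adj M) $$ (i * m + s, j * m + t)) = B s * A * adj (B t)"
      using BA[OF that(3,4)] MAM that by (intro eq_matI) (auto simp del: index_mult_mat)
    then show ?thesis using that by (simp add: P_def tensor_id_index)
  qed
  have "mat_trace (L * P * adj L) = (\<Sum>k<n. \<Sum>c<n * m. (\<Sum>r<n * m. L $$ (k, r) * P $$ (r, c)) * cnj (L $$ (k, c)))"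
    using L p by (simp add: mat_trace_def scalar_prod_def atLeast0LessThan)
  also have "\<dots> = (\<Sum>k<n. \<Sum>j<n. \<Sum>t<m. \<Sum>i<n. \<Sum>s<m.
      C s $$ (k, i) * \<Phi> (B s * A * adj (B t)) $$ (i, j) * cnj (C t $$ (k, j)))"
    by (simp add: sum_lessThan_mult MLi Pi sum_distrib_right)
  also have "\<dots> = (\<Sum>k<n. \<Sum>t<m. \<Sum>j<n. \<Sum>s<m. \<Sum>i<n.
      C s $$ (k, i) * \<Phi> (B s * A * adj (B t)) $$ (i, j) * cnj (C t $$ (k, j)))"
    by (rule sum.cong[OF refl], subst sum.swap, rule sum.cong[OF refl], rule sum.cong[OF refl], rule sum.swap)
  also have "\<dots> = (\<Sum>k<n. \<Sum>t<m. \<Sum>s<m. \<Sum>j<n. \<Sum>i<n.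
      C s $$ (k, i) * \<Phi> (B s * A * adj (B t)) $$ (i, j) * cnj (C t $$ (k, j)))"
    by (rule sum.cong[OF refl], rule sum.cong[OF refl], rule sum.swap)
  also have "\<dots> = (\<Sum>t<m. \<Sum>s<m. \<Sum>k<n. \<Sum>j<n. \<Sum>i<n.
      C s $$ (k, i) * \<Phi> (B s * A * adj (B t)) $$ (i, j) * cnj (C t $$ (k, j)))"
    by (subst sum.swap, rule sum.cong[OF refl], rule sum.swap)
  also have "\<dots> = (\<Sum>t<m. \<Sum>s<m. mat_trace (C s * \<Phi> (B s * A * adj (B t)) * adj (C t)))"
  proof (intro sum.cong refl)
    fix s t assume "t \<in> {..<m}" "s \<in> {..<m}"
    then have st: "s < m" "t < m" by auto
    show "(\<Sum>k<n. \<Sum>j<n. \<Sum>i<n. C s $$ (k, i) * \<Phi> (B s * A * adj (B t)) $$ (i, j) * cnj (C t $$ (k, j)))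
      = mat_trace (C s * \<Phi> (B s * A * adj (B t)) * adj (C t))"
      using C[OF st(1)] C[OF st(2)] lin[OF BA[OF st]]
      by (simp add: mat_trace_def scalar_prod_def atLeast0LessThan sum_distrib_right)
  qed
  also have "\<dots> = (\<Sum>s<m. \<Sum>t<m. mat_trace (C s * \<Phi> (B s * A * adj (B t)) * adj (C t)))"
    by (rule sum.swap)
  finally show ?thesis using psd_trace_nonneg[OF psd_congruence[OF P L]] by simp
qed

text \<open>The expansion of a square in which \<open>W\<close> acts inside the map and
  \<open>Y\<close> outside; trace preservation removes the map from the term with two factors of
  \<open>W\<close>.\<close>

lemma quantum_operation_cauchy_schwarz:
  assumes \<Phi>: "quantum_operation n \<Phi>" and A: "psd_mat n A"
    and W: "W \<in> carrier_mat n n" and Y: "Y \<in> carrier_mat n n"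
  shows "Re (mat_trace (\<Phi> (W * A) * adj Y)) + Re (mat_trace (Y * \<Phi> (A * adj W)))
    \<le> Re (mat_trace (W * A * adj W)) + Re (mat_trace (Y * \<Phi> A * adj Y))"
proof -
  note c = psd_carrier[OF A] W Y mat_adjoint_carrier[OF W] mat_adjoint_carrier[OF Y]
  note \<Phi>c = quantum_operation_carrier[OF \<Phi>]
  \<comment> \<open>Two blocks, (W, 1) inside and (1, -Y) outside, so that the mixed terms carry a
    minus sign.\<close>
  define B where "B s = (if s = 0 then W else 1\<^sub>m n)" for s :: nat
  define C where "C s = (if s = 0 then 1\<^sub>m n else - Y)" for s :: nat
  have one: "adj (1\<^sub>m n) = 1\<^sub>m n" by (rule eq_matI) auto
  have neg: "adj (- Y) = - adj Y" by (rule eq_matI) auto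
  have tneg: "mat_trace (- X) = - mat_trace X" if "X \<in> carrier_mat n n" for X :: "complex mat"
    using that by (auto simp: mat_trace_def sum_negf)
  have tr: "mat_trace (\<Phi> (W * A * adj W)) = mat_trace (W * A * adj W)"
    using \<Phi> c by (simp add: quantum_operation_def trace_preserving_def mult_carrier_mat[of _ n n])
  have BC: "B s \<in> carrier_mat n n" "C s \<in> carrier_mat n n" for s using c by (auto simp: B_def C_def)
  have d: "\<Phi> A \<in> carrier_mat n n" "\<Phi> (W * A) \<in> carrier_mat n n" "\<Phi> (A * adj W) \<in> carrier_mat n n"
    "\<Phi> (W * A * adj W) \<in> carrier_mat n n"
    using c by (auto intro!: \<Phi>c mult_carrier_mat[of _ n n])
  have f: "C 0 * \<Phi> (B 0 * A * adj (B 0)) * adj (C 0) = \<Phi> (W * A * adj W)"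
    "C 0 * \<Phi> (B 0 * A * adj (B 1)) * adj (C 1) = - (\<Phi> (W * A) * adj Y)"
    "C 1 * \<Phi> (B 1 * A * adj (B 0)) * adj (C 0) = - (Y * \<Phi> (A * adj W))"
    "C 1 * \<Phi> (B 1 * A * adj (B 1)) * adj (C 1) = Y * \<Phi> A * adj Y"
    unfolding B_def C_def if_True if_False one neg using c d
    by (simp_all add: one neg mult_carrier_mat[of _ n n] right_mult_one_mat[of _ n n] left_mult_one_mat[of _ n n]
        uminus_mult_left_mat uminus_mult_right_mat)
  have "0 \<le> Re (\<Sum>s<2. \<Sum>t<2. mat_trace (C s * \<Phi> (B s * A * adj (B t)) * adj (C t)))"
    by (rule completely_positive_sum_nonneg[OF _ A \<Phi>c BC]) (use \<Phi> in \<open>simp add: quantum_operation_def\<close>)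
  also have "(\<Sum>s<2. \<Sum>t<2. mat_trace (C s * \<Phi> (B s * A * adj (B t)) * adj (C t)))
    = mat_trace (\<Phi> (W * A * adj W)) + mat_trace (- (\<Phi> (W * A) * adj Y))
      + (mat_trace (- (Y * \<Phi> (A * adj W))) + mat_trace (Y * \<Phi> A * adj Y))"
    using f by (simp add: numeral_2_eq_2)
  also have "\<dots> = mat_trace (W * A * adj W) - mat_trace (\<Phi> (W * A) * adj Y)
      - mat_trace (Y * \<Phi> (A * adj W)) + mat_trace (Y * \<Phi> A * adj Y)"
    unfolding tr using c d by (subst (1 2) tneg) (auto intro!: mult_carrier_mat[of _ n n])
  finally show ?thesis by simp
qed


subsection \<open>Monotonicity under quantum operations\<close>

text \<open>In HOL, \<^term>\<open>ln 0 = 0\<close>, so this is the relative entropy only if the kernel of the second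
  matrix is contained in that of the first.\<close>

definition rel_entropy :: "nat \<Rightarrow> complex mat \<Rightarrow> (nat \<Rightarrow> real) \<Rightarrow> complex mat \<Rightarrow> (nat \<Rightarrow> real) \<Rightarrow> real" where
  "rel_entropy n U a V b = (\<Sum>i<n. \<Sum>j<n. overlap U V i j * a i * (ln (a i) - ln (b j)))"

text \<open>For positive a and b, the integral of \<open>a^2 / (b + t * a) - a / (1 + t)\<close>
  over t > 0 is a (ln a - ln b), the summand of the relative entropy. For t > 0 and nonnegative
  eigenvalues a denominator vanishes only if \<open>a i = 0\<close>, and then the summand is
  0.\<close>

definition quasi_entropy :: "nat \<Rightarrow> complex mat \<Rightarrow> (nat \<Rightarrow> real) \<Rightarrow> complex mat \<Rightarrow> (nat \<Rightarrow> real) \<Rightarrow> real \<Rightarrow> real" where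
  "quasi_entropy n U a V b t = (\<Sum>i<n. \<Sum>j<n. overlap U V i j * ((a i)\<^sup>2 / (b j + t * a i)))"

text \<open>The diagonal entry \<open><v_j, A v_j>\<close> expanded in the eigenbasis of A.\<close>

lemma unitary_conj_spec_diag:
  assumes U: "unitary_mat n U" and V: "unitary_mat n V" and j: "j < n"
  shows "(adj V * spec n U a * V) $$ (j, j) = of_real (\<Sum>i<n. overlap U V i j * a i)"
proof -
  note c = unitary_carrier[OF U] unitary_adj_carrier[OF U] unitary_carrier[OF V] unitary_adj_carrier[OF V]
  have VU: "unitary_mat n (adj V * U)" using U V by (intro unitary_mult unitary_adj)
  have "adj (adj V * U) = adj U * V" using c by (simp add: adj_mult[of _ n n _ n])
  then have e: "cnj ((adj V * U) $$ (j, k)) = (adj U * V) $$ (k, j)" if "k < n" for k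
    using c j that index_adj[of k "adj V * U" j] by (simp del: index_mult_mat(1))
  have "adj V * spec n U a * V = spec n (adj V * U) a"
    using spec_unitary_mult[OF unitary_adj[OF V] U] by simp
  then have "(adj V * spec n U a * V) $$ (j, j)
    = (\<Sum>k<n. of_real (a k) * (cnj (cnj ((adj V * U) $$ (j, k))) * cnj ((adj V * U) $$ (j, k))))"
    by (simp add: spec_index[OF VU j j] mult.assoc del: index_mult_mat(1))
  also have "\<dots> = of_real (\<Sum>i<n. overlap U V i j * a i)"
    by (simp add: e overlap_def complex_norm_square mult_ac del: of_real_power complex_cnj_cnj index_mult_mat(1))
  finally show ?thesis .
qed

lemma overlap_self:
  assumes "unitary_mat n U" "i < n" "j < n"
  shows "overlap U U i j = (if i = j then 1 else 0)"
  using assms by (simp add: overlap_def unitary_mat_def)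

text \<open>Compares the diagonal entries of both sides of \<open>m\<close> in the eigenbasis of the
  mean.\<close>

lemma sum_overlap_mean:
  assumes U: "unitary_mat n U" and V: "unitary_mat n V" and W: "unitary_mat n W"
    and m: "mat_mean (spec n U a) (spec n V b) = spec n W c" and j: "j < n"
  shows "(\<Sum>i<n. overlap U W i j * a i) + (\<Sum>i<n. overlap V W i j * b i) = 2 * c j"
proof -
  note cW = unitary_carrier[OF W] unitary_adj_carrier[OF W]
  have "adj W * spec n W c * W = (1/2) \<cdot>\<^sub>m (adj W * spec n U a * W + adj W * spec n V b * W)"
    unfolding m[symmetric] mat_mean_def using U V cW
    by (simp add: mult_add_distrib_mat[of _ n n _ n] add_mult_distrib_mat[of _ n n _ _ n]
        mult_smult_distrib[of _ n n _ n] mult_smult_assoc_mat[of _ n n _ n] mult_carrier_mat[of _ n n])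
  then have "(adj W * spec n W c * W) $$ (j, j)
    = (1/2) * ((adj W * spec n U a * W) $$ (j, j) + (adj W * spec n V b * W) $$ (j, j))"
    using cW j by (simp del: index_mult_mat(1))
  then have "complex_of_real (\<Sum>i<n. overlap W W i j * c i)
    = of_real ((1/2) * ((\<Sum>i<n. overlap U W i j * a i) + (\<Sum>i<n. overlap V W i j * b i)))"
    by (simp only: unitary_conj_spec_diag[OF U W j] unitary_conj_spec_diag[OF V W j]
        unitary_conj_spec_diag[OF W W j]) simp
  then have "(\<Sum>i<n. overlap W W i j * c i)
    = (1/2) * ((\<Sum>i<n. overlap U W i j * a i) + (\<Sum>i<n. overlap V W i j * b i))"
    using of_real_eq_iff by blast
  moreover have "(\<Sum>i<n. overlap W W i j * c i) = (\<Sum>i<n. c i * (if i = j then 1 else 0))"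
    by (intro sum.cong refl) (use j in \<open>simp add: overlap_self[OF W]\<close>)
  ultimately show ?thesis using j by (simp add: sum_mult_delta)
qed

lemma rel_entropy_eq:
  assumes U: "unitary_mat n U" and W: "unitary_mat n W"
  shows "rel_entropy n U a W c = (\<Sum>i<n. xlnx (a i)) - (\<Sum>j<n. (\<Sum>i<n. overlap U W i j * a i) * ln (c j))"
proof -
  have "rel_entropy n U a W c = (\<Sum>i<n. \<Sum>j<n. overlap U W i j * xlnx (a i))
      - (\<Sum>i<n. \<Sum>j<n. overlap U W i j * a i * ln (c j))"
    by (simp add: rel_entropy_def xlnx_def right_diff_distrib sum_subtractf mult.assoc)
  also have "(\<Sum>i<n. \<Sum>j<n. overlap U W i j * a i * ln (c j)) = (\<Sum>j<n. (\<Sum>i<n. overlap U W i j * a i) * ln (c j))"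
    by (subst sum.swap) (simp add: sum_distrib_right)
  finally show ?thesis by (simp add: sum_overlap_left[OF U W])
qed

text \<open>By \<open>sum_overlap_mean\<close> the two cross terms with \<open>ln (c j)\<close>
  combine to twice the entropy sum of the mean.\<close>

lemma QJSD_eq_rel_entropy:
  assumes U: "unitary_mat n U" and V: "unitary_mat n V" and W: "unitary_mat n W"
    and m: "mat_mean (spec n U a) (spec n V b) = spec n W c"
  shows "QJSD (spec n U a) (spec n V b) = (rel_entropy n U a W c + rel_entropy n V b W c) / (2 * ln 2)"
proof -
  have "rel_entropy n U a W c + rel_entropy n V b W c = (\<Sum>i<n. xlnx (a i)) + (\<Sum>i<n. xlnx (b i))
    - (\<Sum>j<n. ((\<Sum>i<n. overlap U W i j * a i) + (\<Sum>i<n. overlap V W i j * b i)) * ln (c j))"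
    by (simp add: rel_entropy_eq U V W distrib_right sum.distrib)
  also have "(\<Sum>j<n. ((\<Sum>i<n. overlap U W i j * a i) + (\<Sum>i<n. overlap V W i j * b i)) * ln (c j))
    = 2 * (\<Sum>j<n. xlnx (c j))"
    unfolding sum_distrib_left by (intro sum.cong refl) (simp add: sum_overlap_mean[OF U V W m] xlnx_def)
  finally show ?thesis
    unfolding QJSD_spec[OF U V W m] by (simp add: diff_divide_distrib add_divide_distrib)
qed

text \<open>The quasi-entropy is the maximum over \<open>Y\<close> of the concave quadratic function
  \<open>2 Re tr (Y\<^sup>* \<rho>) - tr (Y \<sigma> Y\<^sup>*) - t tr (Y\<^sup>* \<rho> Y)\<close>; the equation for \<open>Y\<close> is its
  stationarity condition.\<close>

lemma quasi_entropy_optimizer: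
  assumes U: "unitary_mat n U" and V: "unitary_mat n V"
    and a: "\<And>i. i < n \<Longrightarrow> 0 \<le> a i" and b: "\<And>i. i < n \<Longrightarrow> 0 \<le> b i" and t: "0 < t"
  obtains Y where "Y \<in> carrier_mat n n"
    "Y * spec n V b + of_real t \<cdot>\<^sub>m (spec n U a * Y) = spec n U a"
    "Re (mat_trace (Y * spec n V b * adj Y)) + t * Re (mat_trace (adj Y * spec n U a * Y)) = quasi_entropy n U a V b t"
    "Re (mat_trace (adj Y * spec n U a)) = quasi_entropy n U a V b t"
proof -
  note c = unitary_carrier[OF U] unitary_adj_carrier[OF U] unitary_carrier[OF V] unitary_adj_carrier[OF V]
  note ms = assoc_mult_mat[of _ n n _ n _ n] mult_carrier_mat[of _ n n]
  define w where "w i j = (adj U * V) $$ (i, j)" for i j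
  \<comment> \<open>In the eigenbases stationarity reads
    \<open>y_ij * (b j + t * a i) = a i * w i j\<close>; where the factor is 0 so is
    \<open>a i\<close>, and the default value of division still gives a solution.\<close>
  define y where "y = mat n n (\<lambda>(i, j). of_real (a i / (b j + t * a i)) * w i j)"
  have y: "y \<in> carrier_mat n n" by (simp add: y_def)
  define Y where "Y = U * y * adj V"
  have Y: "Y \<in> carrier_mat n n" "adj Y \<in> carrier_mat n n" using c y by (auto simp: Y_def ms mat_adjoint_carrier)
  define Da Db where "Da = mat_diag n (\<lambda>i. complex_of_real (a i))" and "Db = mat_diag n (\<lambda>i. complex_of_real (b i))"
  have D: "Da \<in> carrier_mat n n" "Db \<in> carrier_mat n n" by (simp_all add: Da_def Db_def)
  have nz: "b j + t * a i \<noteq> 0 \<or> a i = 0" if "i < n" "j < n" for i j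
    using a[OF that(1)] b[OF that(2)] t by (cases "a i = 0") (auto simp: add_nonneg_eq_0_iff)
  have entry: "y * Db + of_real t \<cdot>\<^sub>m (Da * y) = Da * (adj U * V)"
  proof (rule eq_matI)
    fix i j assume "i < dim_row (Da * (adj U * V))" "j < dim_col (Da * (adj U * V))"
    then have ij: "i < n" "j < n" using c D by auto
    have "(y * Db + of_real t \<cdot>\<^sub>m (Da * y)) $$ (i, j) = y $$ (i, j) * of_real (b j + t * a i)"
      using ij y by (simp add: Da_def Db_def mat_diag_mult_left[of _ n n] mat_diag_mult_right[of _ n n] algebra_simps)
    also have "y $$ (i, j) = of_real (a i / (b j + t * a i)) * w i j" using ij by (simp add: y_def)
    also have "of_real (a i / (b j + t * a i)) * w i j * of_real (b j + t * a i)
      = of_real (a i / (b j + t * a i) * (b j + t * a i)) * w i j"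
      unfolding of_real_mult[of "a i / (b j + t * a i)"] by (simp only: mult_ac)
    also have "a i / (b j + t * a i) * (b j + t * a i) = a i" using nz[OF ij] by auto
    also have "of_real (a i) * w i j = (Da * (adj U * V)) $$ (i, j)"
      using ij c by (simp add: Da_def w_def mat_diag_mult_left[of _ n n] mult_carrier_mat[of _ n n] del: index_mult_mat(1))
    finally show "(y * Db + of_real t \<cdot>\<^sub>m (Da * y)) $$ (i, j) = (Da * (adj U * V)) $$ (i, j)" .
  qed (use c D y in auto)
  have "Y * spec n V b = U * (y * (Db * adj V))"
    using c D y unitary_cancel(1)[OF V, of "Db * adj V" n] by (simp add: Y_def spec_def Db_def[symmetric] ms)
  also have "\<dots> = U * (y * Db) * adj V" using c D y by (simp add: ms)
  finally have 1: "Y * spec n V b = U * (y * Db) * adj V" .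
  have "spec n U a * Y = U * (Da * (y * adj V))"
    using c D y unitary_cancel(1)[OF U, of "y * adj V" n] by (simp add: Y_def spec_def Da_def[symmetric] ms)
  also have "\<dots> = U * (Da * y) * adj V" using c D y by (simp add: ms)
  finally have 2: "spec n U a * Y = U * (Da * y) * adj V" .
  have "Y * spec n V b + of_real t \<cdot>\<^sub>m (spec n U a * Y) = U * (y * Db + of_real t \<cdot>\<^sub>m (Da * y)) * adj V"
    unfolding 1 2 using c D y
    by (simp add: mult_add_distrib_mat[of _ n n _ n] add_mult_distrib_mat[of _ n n _ _ n]
        mult_smult_distrib[of _ n n _ n] mult_smult_assoc_mat[of _ n n _ n] mult_carrier_mat[of _ n n])
  also have "\<dots> = U * (Da * (adj U * (V * adj V)))" unfolding entry using c D by (simp add: ms)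
  also have "\<dots> = spec n U a" using V c D by (simp add: unitary_mat_def spec_def Da_def ms)
  finally have eq: "Y * spec n V b + of_real t \<cdot>\<^sub>m (spec n U a * Y) = spec n U a" .
  have yY: "adj U * Y * V = y"
    using c y V unitary_cancel(1)[OF U, of y n] by (simp add: Y_def ms) (simp add: unitary_mat_def)
  define L R where "L = mat_trace (Y * spec n V b * adj Y)" and "R = mat_trace (adj Y * spec n U a * Y)"
  have LR: "L + of_real t * R = of_real (quasi_entropy n U a V b t)"
  proof -
    have "(b j + t * a i) * (cmod (y $$ (i, j)))\<^sup>2 = overlap U V i j * ((a i)\<^sup>2 / (b j + t * a i))"
      if "i < n" "j < n" for i j
    proof -
      have "(cmod (y $$ (i, j)))\<^sup>2 = (a i / (b j + t * a i))\<^sup>2 * overlap U V i j"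
        using that by (simp add: y_def w_def overlap_def norm_mult power_mult_distrib norm_divide power_divide
            flip: of_real_add of_real_mult del: index_mult_mat(1))
      then show ?thesis using nz[OF that] by (auto simp: power2_eq_square)
    qed
    then have "(\<Sum>i<n. \<Sum>j<n. (b j + t * a i) * (cmod (y $$ (i, j)))\<^sup>2) = quasi_entropy n U a V b t"
      unfolding quasi_entropy_def by (intro sum.cong) auto
    then have "quasi_entropy n U a V b t = (\<Sum>i<n. \<Sum>j<n. b j * (cmod (y $$ (i, j)))\<^sup>2)
      + t * (\<Sum>i<n. \<Sum>j<n. a i * (cmod (y $$ (i, j)))\<^sup>2)"
      by (simp add: distrib_right sum.distrib sum_distrib_left mult.assoc)
    then show ?thesis
      unfolding L_def R_def mat_trace_spec_left[OF U V Y(1)] mat_trace_spec_right[OF U V Y(1)] yY by simp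
  qed
  \<comment> \<open>Pairing the stationarity equation with \<open>adj Y\<close> shows that the
    linear term equals the quadratic one.\<close>
  have "adj Y * spec n U a = adj Y * (Y * spec n V b + of_real t \<cdot>\<^sub>m (spec n U a * Y))" by (simp only: eq)
  also have "\<dots> = adj Y * (Y * spec n V b) + of_real t \<cdot>\<^sub>m (adj Y * spec n U a * Y)"
    using Y U V by (simp add: mult_add_distrib_mat[of _ n n _ n] mult_smult_distrib[of _ n n _ n] ms)
  also have "mat_trace \<dots> = mat_trace (adj Y * (Y * spec n V b)) + of_real t * R"
    unfolding R_def using Y U V by (subst mat_trace_add[of _ n]) (auto simp: mat_trace_smult[of _ n] mult_carrier_mat[of _ n n])
  also have "mat_trace (adj Y * (Y * spec n V b)) = L"
    unfolding L_def using Y V by (intro mat_trace_comm[of _ n n]) (auto simp: mult_carrier_mat[of _ n n])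
  finally have T: "mat_trace (adj Y * spec n U a) = of_real (quasi_entropy n U a V b t)" using LR by simp
  show thesis
  proof (rule that[OF Y(1) eq])
    show "Re (mat_trace (Y * spec n V b * adj Y)) + t * Re (mat_trace (adj Y * spec n U a * Y)) = quasi_entropy n U a V b t"
      using arg_cong[OF LR, of Re] by (simp add: L_def R_def)
  qed (simp add: T)
qed

text \<open>Let Z and Y be the optimizers for the original pair and for its image. Rewriting the
  image of the first state by the equation for Z and applying Cauchy-Schwarz to both states bounds
  twice the image value by the sum of the two values.\<close>

lemma quasi_entropy_mono:
  assumes \<Phi>: "quantum_operation n \<Phi>"
    and U: "unitary_mat n U" and V: "unitary_mat n V" and U': "unitary_mat n U'" and V': "unitary_mat n V'"
    and a: "\<And>i. i < n \<Longrightarrow> 0 \<le> a i" and b: "\<And>i. i < n \<Longrightarrow> 0 \<le> b i"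
    and a': "\<And>i. i < n \<Longrightarrow> 0 \<le> a' i" and b': "\<And>i. i < n \<Longrightarrow> 0 \<le> b' i"
    and im: "\<Phi> (spec n U a) = spec n U' a'" "\<Phi> (spec n V b) = spec n V' b'"
    and t: "0 < t"
  shows "quasi_entropy n U' a' V' b' t \<le> quasi_entropy n U a V b t"
proof -
  note ms = assoc_mult_mat[of _ n n _ n _ n] mult_carrier_mat[of _ n n]
  define \<rho> \<sigma> where "\<rho> = spec n U a" and "\<sigma> = spec n V b"
  have psd: "psd_mat n \<rho>" "psd_mat n \<sigma>" using a b by (auto simp: \<rho>_def \<sigma>_def psd_spec U V)
  have c: "\<rho> \<in> carrier_mat n n" "\<sigma> \<in> carrier_mat n n" "adj \<rho> = \<rho>" "adj \<sigma> = \<sigma>"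
    by (auto simp: \<rho>_def \<sigma>_def U V adj_spec)
  obtain Z where Z: "Z \<in> carrier_mat n n" "Z * \<sigma> + of_real t \<cdot>\<^sub>m (\<rho> * Z) = \<rho>"
    "Re (mat_trace (Z * \<sigma> * adj Z)) + t * Re (mat_trace (adj Z * \<rho> * Z)) = quasi_entropy n U a V b t"
    unfolding \<rho>_def \<sigma>_def using quasi_entropy_optimizer[where a = a and b = b, OF U V a b t] by blast
  obtain Y where Y: "Y \<in> carrier_mat n n"
    "Re (mat_trace (Y * \<Phi> \<sigma> * adj Y)) + t * Re (mat_trace (adj Y * \<Phi> \<rho> * Y)) = quasi_entropy n U' a' V' b' t"
    "Re (mat_trace (adj Y * \<Phi> \<rho>)) = quasi_entropy n U' a' V' b' t"
    unfolding \<rho>_def \<sigma>_def im using quasi_entropy_optimizer[where a = a' and b = b', OF U' V' a' b' t] by blast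
  note Z' = mat_adjoint_carrier[OF Z(1)] and Y' = mat_adjoint_carrier[OF Y(1)]
  have \<Phi>c: "\<Phi> \<rho> \<in> carrier_mat n n" "adj (\<Phi> \<rho>) = \<Phi> \<rho>" using U' im by (auto simp: \<rho>_def adj_spec)
  have d: "Z * \<sigma> \<in> carrier_mat n n" "\<rho> * Z \<in> carrier_mat n n" "\<sigma> * adj Z \<in> carrier_mat n n" "adj Z * \<rho> \<in> carrier_mat n n"
    using Z Z' c by (auto intro: mult_carrier_mat)
  note \<Phi>d = d[THEN quantum_operation_carrier[OF \<Phi>]]
  have lin: "\<Phi> (A + of_real t \<cdot>\<^sub>m B) = \<Phi> A + of_real t \<cdot>\<^sub>m \<Phi> B" if "A \<in> carrier_mat n n" "B \<in> carrier_mat n n" for A B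
    using \<Phi> that by (simp add: quantum_operation_def linear_mat_map_def)
  \<comment> \<open>The Cauchy-Schwarz bounds contain cross terms with \<open>Z\<close> and with
    \<open>adj Z\<close>, so the equation for \<open>Z\<close> is also used in its adjoint
    form.\<close>
  have "\<rho> = adj (Z * \<sigma> + of_real t \<cdot>\<^sub>m (\<rho> * Z))" using Z(2) c(3) by simp
  also have "\<dots> = \<sigma> * adj Z + of_real t \<cdot>\<^sub>m (adj Z * \<rho>)"
    using c Z(1) d by (simp add: adj_add[of _ n n] adj_smult adj_mult[of _ n n _ n])
  finally have \<rho>': "\<Phi> \<rho> = \<Phi> (\<sigma> * adj Z) + of_real t \<cdot>\<^sub>m \<Phi> (adj Z * \<rho>)" using lin[OF d(3,4)] by simp
  have \<rho>: "\<Phi> \<rho> = \<Phi> (Z * \<sigma>) + of_real t \<cdot>\<^sub>m \<Phi> (\<rho> * Z)" using lin[OF d(1,2)] Z(2) by simp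
  have 1: "Re (mat_trace (\<Phi> (Z * \<sigma>) * adj Y)) + Re (mat_trace (Y * \<Phi> (\<sigma> * adj Z)))
    \<le> Re (mat_trace (Z * \<sigma> * adj Z)) + Re (mat_trace (Y * \<Phi> \<sigma> * adj Y))"
    by (rule quantum_operation_cauchy_schwarz[OF \<Phi> psd(2) Z(1) Y(1)])
  have 2: "Re (mat_trace (\<Phi> (adj Z * \<rho>) * Y)) + Re (mat_trace (adj Y * \<Phi> (\<rho> * Z)))
    \<le> Re (mat_trace (adj Z * \<rho> * Z)) + Re (mat_trace (adj Y * \<Phi> \<rho> * Y))"
    using quantum_operation_cauchy_schwarz[OF \<Phi> psd(1) Z' Y'] by simp
  have "mat_trace (adj Y * \<Phi> \<rho>) = mat_trace (adj Y * \<Phi> (Z * \<sigma>)) + of_real t * mat_trace (adj Y * \<Phi> (\<rho> * Z))"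
    unfolding \<rho> using Y' \<Phi>d
    by (simp add: mult_add_distrib_mat[of _ n n _ n] mult_smult_distrib[of _ n n _ n] mat_trace_add[of _ n]
        mat_trace_smult[of _ n] mult_carrier_mat[of _ n n])
  also have "mat_trace (adj Y * \<Phi> (Z * \<sigma>)) = mat_trace (\<Phi> (Z * \<sigma>) * adj Y)"
    by (rule mat_trace_comm[OF Y' \<Phi>d(1)])
  finally have 3: "Re (mat_trace (adj Y * \<Phi> \<rho>)) = Re (mat_trace (\<Phi> (Z * \<sigma>) * adj Y)) + t * Re (mat_trace (adj Y * \<Phi> (\<rho> * Z)))"
    by simp
  have "mat_trace (Y * \<Phi> \<rho>) = mat_trace (Y * \<Phi> (\<sigma> * adj Z)) + of_real t * mat_trace (Y * \<Phi> (adj Z * \<rho>))"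
    unfolding \<rho>' using Y(1) \<Phi>d
    by (simp add: mult_add_distrib_mat[of _ n n _ n] mult_smult_distrib[of _ n n _ n] mat_trace_add[of _ n]
        mat_trace_smult[of _ n] mult_carrier_mat[of _ n n])
  also have "mat_trace (Y * \<Phi> (adj Z * \<rho>)) = mat_trace (\<Phi> (adj Z * \<rho>) * Y)"
    by (rule mat_trace_comm[OF Y(1) \<Phi>d(4)])
  finally have 4: "Re (mat_trace (Y * \<Phi> \<rho>)) = Re (mat_trace (Y * \<Phi> (\<sigma> * adj Z))) + t * Re (mat_trace (\<Phi> (adj Z * \<rho>) * Y))"
    by simp
  have "mat_trace (Y * \<Phi> \<rho>) = mat_trace (\<Phi> \<rho> * Y)" by (rule mat_trace_comm[OF Y(1) \<Phi>c(1)])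
  also have "\<Phi> \<rho> * Y = adj (adj Y * \<Phi> \<rho>)" using Y Y' \<Phi>c by (simp add: adj_mult[of _ n n _ n])
  also have "mat_trace \<dots> = cnj (mat_trace (adj Y * \<Phi> \<rho>))"
    using Y' \<Phi>c by (intro mat_trace_adj[of _ n]) (simp add: mult_carrier_mat[of _ n n])
  \<comment> \<open>Hence the two linear terms, expanded in \<open>3\<close> and \<open>4\<close>,
    have the same real part and together give twice the value at \<open>Y\<close>.\<close>
  finally have 5: "Re (mat_trace (Y * \<Phi> \<rho>)) = Re (mat_trace (adj Y * \<Phi> \<rho>))" by simp
  have "t * (Re (mat_trace (\<Phi> (adj Z * \<rho>) * Y)) + Re (mat_trace (adj Y * \<Phi> (\<rho> * Z))))
    \<le> t * (Re (mat_trace (adj Z * \<rho> * Z)) + Re (mat_trace (adj Y * \<Phi> \<rho> * Y)))"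
    using 2 t by (intro mult_left_mono) auto
  then have "2 * Re (mat_trace (adj Y * \<Phi> \<rho>))
    \<le> (Re (mat_trace (Z * \<sigma> * adj Z)) + t * Re (mat_trace (adj Z * \<rho> * Z)))
      + (Re (mat_trace (Y * \<Phi> \<sigma> * adj Y)) + t * Re (mat_trace (adj Y * \<Phi> \<rho> * Y)))"
    using 1 3 4 5 by (simp add: distrib_left)
  then show ?thesis unfolding Z(3) Y(2) Y(3) by simp
qed

text \<open>\<open>\<integral>\<^sub>0\<^sup>T (quasi_entropy t - tr \<rho> / (1 + t)) dt\<close> in closed form.\<close>

definition rel_entropy_upto :: "nat \<Rightarrow> complex mat \<Rightarrow> (nat \<Rightarrow> real) \<Rightarrow> complex mat \<Rightarrow> (nat \<Rightarrow> real) \<Rightarrow> real \<Rightarrow> real" where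
  "rel_entropy_upto n U a V b T =
    (\<Sum>i<n. \<Sum>j<n. overlap U V i j * a i * (ln (b j + T * a i) - ln (1 + T) - ln (b j)))"

lemma rel_entropy_upto_0: "rel_entropy_upto n U a V b 0 = 0"
  by (simp add: rel_entropy_upto_def)

text \<open>The support condition covers the end point T = 0: there the argument of the logarithm is
  \<open>b j\<close>, which must be positive in each term that does not vanish.\<close>

lemma has_real_derivative_rel_entropy_upto:
  assumes U: "unitary_mat n U" and V: "unitary_mat n V"
    and a: "\<And>i. i < n \<Longrightarrow> 0 \<le> a i" and b: "\<And>i. i < n \<Longrightarrow> 0 \<le> b i"
    and supp: "\<And>i j. i < n \<Longrightarrow> j < n \<Longrightarrow> b j = 0 \<Longrightarrow> overlap U V i j * a i = 0"
    and T: "0 \<le> T"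
  shows "(rel_entropy_upto n U a V b has_real_derivative
    quasi_entropy n U a V b T - (\<Sum>i<n. a i) / (1 + T)) (at T)"
proof -
  have d: "((\<lambda>T. overlap U V i j * a i * (ln (b j + T * a i) - ln (1 + T) - ln (b j))) has_real_derivative
     overlap U V i j * ((a i)\<^sup>2 / (b j + T * a i)) - overlap U V i j * (a i / (1 + T))) (at T)"
    if ij: "i < n" "j < n" for i j
  proof (cases "overlap U V i j * a i = 0")
    case True
    then have "overlap U V i j = 0 \<or> a i = 0" by simp
    then show ?thesis by auto
  next
    case False
    then have p: "0 < a i" "0 < b j" using a[OF ij(1)] b[OF ij(2)] supp[OF ij] by (auto simp: less_le)
    then have "0 < b j + T * a i" "0 < 1 + T" using T by (auto intro: add_pos_nonneg)
    then show ?thesis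
      by (auto intro!: derivative_eq_intros simp: power2_eq_square algebra_simps)
  qed
  have "((\<lambda>T. \<Sum>i<n. \<Sum>j<n. overlap U V i j * a i * (ln (b j + T * a i) - ln (1 + T) - ln (b j)))
    has_real_derivative (\<Sum>i<n. \<Sum>j<n. overlap U V i j * ((a i)\<^sup>2 / (b j + T * a i)) - overlap U V i j * (a i / (1 + T)))) (at T)"
    by (intro DERIV_sum d) auto
  moreover have "(\<Sum>i<n. \<Sum>j<n. overlap U V i j * ((a i)\<^sup>2 / (b j + T * a i)) - overlap U V i j * (a i / (1 + T)))
    = quasi_entropy n U a V b T - (\<Sum>i<n. a i) / (1 + T)"
    unfolding sum_subtractf quasi_entropy_def sum_divide_distrib sum_overlap_left[OF U V] ..
  ultimately show ?thesis unfolding rel_entropy_upto_def[abs_def] by simp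
qed

lemma tendsto_rel_entropy_upto:
  assumes a: "\<And>i. i < n \<Longrightarrow> 0 \<le> a i"
  shows "(rel_entropy_upto n U a V b \<longlongrightarrow> rel_entropy n U a V b) at_top"
  unfolding rel_entropy_upto_def[abs_def] rel_entropy_def
proof (intro tendsto_sum)
  fix i j assume "i \<in> {..<n}" "j \<in> {..<n}"
  then have i: "0 \<le> a i" using a by simp
  show "((\<lambda>T. overlap U V i j * a i * (ln (b j + T * a i) - ln (1 + T) - ln (b j)))
    \<longlongrightarrow> overlap U V i j * a i * (ln (a i) - ln (b j))) at_top"
  proof (cases "a i = 0")
    case False
    then have "0 < a i" using i by simp
    then have "((\<lambda>T. ln (b j + T * a i) - ln (1 + T)) \<longlongrightarrow> ln (a i)) at_top" by real_asymp
    then show ?thesis by (intro tendsto_intros)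
  qed simp
qed

text \<open>Monotonicity of the quasi-entropies, integrated over t. The subtracted terms with 1 + T
  agree on both sides since the trace is preserved.\<close>

lemma rel_entropy_mono:
  assumes \<Phi>: "quantum_operation n \<Phi>"
    and U: "unitary_mat n U" and V: "unitary_mat n V" and U': "unitary_mat n U'" and V': "unitary_mat n V'"
    and a: "\<And>i. i < n \<Longrightarrow> 0 \<le> a i" and b: "\<And>i. i < n \<Longrightarrow> 0 \<le> b i"
    and a': "\<And>i. i < n \<Longrightarrow> 0 \<le> a' i" and b': "\<And>i. i < n \<Longrightarrow> 0 \<le> b' i"
    and im: "\<Phi> (spec n U a) = spec n U' a'" "\<Phi> (spec n V b) = spec n V' b'"
    and supp: "\<And>i j. i < n \<Longrightarrow> j < n \<Longrightarrow> b j = 0 \<Longrightarrow> overlap U V i j * a i = 0"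
    and supp': "\<And>i j. i < n \<Longrightarrow> j < n \<Longrightarrow> b' j = 0 \<Longrightarrow> overlap U' V' i j * a' i = 0"
  shows "rel_entropy n U' a' V' b' \<le> rel_entropy n U a V b"
proof -
  define D where "D = rel_entropy n U a V b - rel_entropy n U' a' V' b'"
  \<comment> \<open>\<open>R T\<close> is the part of the difference \<open>D\<close> contributed by
    parameters beyond T.\<close>
  define R where "R T = D - (rel_entropy_upto n U a V b T - rel_entropy_upto n U' a' V' b' T)" for T
  have "complex_of_real (\<Sum>i<n. a' i) = mat_trace (\<Phi> (spec n U a))" by (simp add: im mat_trace_spec[OF U'])
  also have "\<dots> = of_real (\<Sum>i<n. a i)"
    using \<Phi> U mat_trace_spec[OF U, of a] by (simp add: quantum_operation_def trace_preserving_def)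
  finally have tr: "(\<Sum>i<n. a' i) = (\<Sum>i<n. a i)" using of_real_eq_iff by blast
  have der: "(R has_real_derivative quasi_entropy n U' a' V' b' T - quasi_entropy n U a V b T) (at T)"
    if T: "0 \<le> T" for T
  proof -
    have "(R has_real_derivative 0 - ((quasi_entropy n U a V b T - (\<Sum>i<n. a i) / (1 + T))
      - (quasi_entropy n U' a' V' b' T - (\<Sum>i<n. a' i) / (1 + T)))) (at T)"
      unfolding R_def[abs_def]
      by (intro DERIV_diff DERIV_const has_real_derivative_rel_entropy_upto U V U' V' a b a' b' supp supp' T)
    then show ?thesis by (simp add: tr)
  qed
  have "0 \<le> R 0"
  proof (rule nonneg_if_deriv_nonpos)
    fix T :: real assume T: "0 < T"
    show "(R has_real_derivative quasi_entropy n U' a' V' b' T - quasi_entropy n U a V b T) (at T)"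
      using der T by simp
    have "quasi_entropy n U' a' V' b' T \<le> quasi_entropy n U a V b T"
      by (rule quasi_entropy_mono[OF \<Phi> U V U' V' a b a' b' im T])
    then show "quasi_entropy n U' a' V' b' T - quasi_entropy n U a V b T \<le> 0" by simp
  next
    show "(R \<longlongrightarrow> R 0) (at_right 0)"
      using DERIV_isCont[OF der[of 0]] by (simp add: isCont_def filterlim_at_split)
    have "(R \<longlongrightarrow> D - (rel_entropy n U a V b - rel_entropy n U' a' V' b')) at_top"
      unfolding R_def[abs_def] by (intro tendsto_intros tendsto_rel_entropy_upto a a')
    then show "(R \<longlongrightarrow> 0) at_top" by (simp add: D_def)
  qed
  then show ?thesis by (simp add: R_def D_def rel_entropy_upto_0)
qed

text \<open>The kernel of the mean lies in the kernels of both matrices: by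
  \<open>sum_overlap_mean\<close> nonnegative terms add up to 0. This supplies the support condition
  of \<open>rel_entropy_mono\<close>.\<close>

lemma overlap_mean_support:
  assumes U: "unitary_mat n U" and V: "unitary_mat n V" and W: "unitary_mat n W"
    and m: "mat_mean (spec n U a) (spec n V b) = spec n W c"
    and a: "\<And>i. i < n \<Longrightarrow> 0 \<le> a i" and b: "\<And>i. i < n \<Longrightarrow> 0 \<le> b i"
    and ij: "i < n" "j < n" and c: "c j = 0"
  shows "overlap U W i j * a i = 0" "overlap V W i j * b i = 0"
proof -
  have "0 \<le> (\<Sum>i<n. overlap U W i j * a i)" "0 \<le> (\<Sum>i<n. overlap V W i j * b i)"
    using a b by (auto intro!: sum_nonneg mult_nonneg_nonneg)
  then have "(\<Sum>i<n. overlap U W i j * a i) = 0" "(\<Sum>i<n. overlap V W i j * b i) = 0"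
    using sum_overlap_mean[OF U V W m ij(2)] c by auto
  then show "overlap U W i j * a i = 0" "overlap V W i j * b i = 0"
    using sum_nonneg_eq_0_iff[of "{..<n}" "\<lambda>i. overlap U W i j * a i"]
      sum_nonneg_eq_0_iff[of "{..<n}" "\<lambda>i. overlap V W i j * b i"] a b ij(1)
    by (auto simp del: mult_eq_0_iff)
qed

theorem QJSD_quantum_operation_le:
  assumes \<Phi>: "quantum_operation n \<Phi>" and X: "psd_mat n X" and Y: "psd_mat n Y"
  shows "QJSD (\<Phi> X) (\<Phi> Y) \<le> QJSD X Y"
proof -
  note M = psd_mean[OF X Y] and X' = quantum_operation_psd[OF \<Phi> X] and Y' = quantum_operation_psd[OF \<Phi> Y]
  note M' = psd_mean[OF X' Y']
  obtain U a where U: "unitary_mat n U" "X = spec n U a" "\<And>i. i < n \<Longrightarrow> 0 \<le> a i" using psd_spectral[OF X] by blast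
  obtain V b where V: "unitary_mat n V" "Y = spec n V b" "\<And>i. i < n \<Longrightarrow> 0 \<le> b i" using psd_spectral[OF Y] by blast
  obtain W c where W: "unitary_mat n W" "mat_mean X Y = spec n W c" "\<And>i. i < n \<Longrightarrow> 0 \<le> c i" using psd_spectral[OF M] by blast
  obtain U' a' where U': "unitary_mat n U'" "\<Phi> X = spec n U' a'" "\<And>i. i < n \<Longrightarrow> 0 \<le> a' i" using psd_spectral[OF X'] by blast
  obtain V' b' where V': "unitary_mat n V'" "\<Phi> Y = spec n V' b'" "\<And>i. i < n \<Longrightarrow> 0 \<le> b' i" using psd_spectral[OF Y'] by blast
  obtain W' c' where W': "unitary_mat n W'" "mat_mean (\<Phi> X) (\<Phi> Y) = spec n W' c'" "\<And>i. i < n \<Longrightarrow> 0 \<le> c' i"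
    using psd_spectral[OF M'] by blast
  note m = W(2)[unfolded U(2) V(2)] and m' = W'(2)[unfolded U'(2) V'(2)]
  \<comment> \<open>Linearity sends the mean to the mean of the images, so both relative entropies
    are taken to corresponding matrices.\<close>
  have im: "\<Phi> (spec n W c) = spec n W' c'"
    using \<Phi> psd_carrier[OF X] psd_carrier[OF Y]
    unfolding W(2)[symmetric] W'(2)[symmetric]
    by (simp add: mat_mean_def quantum_operation_def linear_mat_map_def)
  have "rel_entropy n U' a' W' c' \<le> rel_entropy n U a W c"
    by (rule rel_entropy_mono[OF \<Phi> U(1) W(1) U'(1) W'(1) U(3) W(3) U'(3) W'(3) _ im])
      (use U U' overlap_mean_support(1)[OF U(1) V(1) W(1) m U(3) V(3)]
        overlap_mean_support(1)[OF U'(1) V'(1) W'(1) m' U'(3) V'(3)] in auto)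
  moreover have "rel_entropy n V' b' W' c' \<le> rel_entropy n V b W c"
    by (rule rel_entropy_mono[OF \<Phi> V(1) W(1) V'(1) W'(1) V(3) W(3) V'(3) W'(3) _ im])
      (use V V' overlap_mean_support(2)[OF U(1) V(1) W(1) m U(3) V(3)]
        overlap_mean_support(2)[OF U'(1) V'(1) W'(1) m' U'(3) V'(3)] in auto)
  ultimately show ?thesis
    unfolding U'(2) V'(2)
    unfolding U(2) V(2) QJSD_eq_rel_entropy[OF U(1) V(1) W(1) m] QJSD_eq_rel_entropy[OF U'(1) V'(1) W'(1) m']
    by (intro divide_right_mono add_mono) auto
qed

section \<open>Boundedness of the supremum and the conclusion\<close>

lemma QJSD_density_le:
  assumes X: "X \<in> density_mats n" and Y: "Y \<in> density_mats n"
  shows "QJSD X Y \<le> real n / ln 2"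
proof -
  have psd: "psd_mat n X" "psd_mat n Y" and tr: "mat_trace X = 1" "mat_trace Y = 1"
    using X Y by (auto simp: density_mats_def)
  have S0: "0 \<le> von_neumann_entropy Z" if Z: "psd_mat n Z" "mat_trace Z = 1" for Z
  proof -
    obtain U a where U: "unitary_mat n U" "Z = spec n U a" "\<And>i. i < n \<Longrightarrow> 0 \<le> a i" using psd_spectral[OF Z(1)] by blast
    have "complex_of_real (\<Sum>i<n. a i) = of_real 1" using Z(2) mat_trace_spec[OF U(1), of a] U(2) by simp
    then have sum: "(\<Sum>i<n. a i) = 1" using of_real_eq_iff by blast
    have "xlnx (a i) \<le> 0" if "i < n" for i
    proof -
      have "a i \<le> (\<Sum>i<n. a i)" using that U(3) by (intro member_le_sum) auto
      then show ?thesis using U(3)[OF that] sum by (cases "a i = 0") (auto simp: xlnx_def mult_nonneg_nonpos)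
    qed
    then have "(\<Sum>i<n. xlnx (a i)) \<le> 0" by (intro sum_nonpos) auto
    then show ?thesis unfolding U(2) entropy_spec[OF U(1)] by (simp add: divide_nonpos_pos)
  qed
  obtain W c where W: "unitary_mat n W" "mat_mean X Y = spec n W c" "\<And>i. i < n \<Longrightarrow> 0 \<le> c i"
    using psd_spectral[OF psd_mean[OF psd]] by blast
  \<comment> \<open>From \<open>ln y \<le> y - 1\<close> at y = 1 / c. The resulting bound is crude,
    but any finite bound serves the supremum.\<close>
  have "- xlnx (c i) \<le> 1" if "i < n" for i
  proof (cases "c i = 0")
    case False
    then have p: "0 < c i" using W(3)[OF that] by simp
    have "ln (1 / c i) \<le> 1 / c i - 1" using p by (intro ln_le_minus_one) simp
    then have "c i * ln (1 / c i) \<le> c i * (1 / c i - 1)" using p by (intro mult_left_mono) auto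
    then show ?thesis using p by (simp add: xlnx_def ln_div right_diff_distrib)
  qed (simp add: xlnx_def)
  then have "(\<Sum>i<n. - xlnx (c i)) \<le> (\<Sum>i<n. 1)" by (intro sum_mono) auto
  then have "von_neumann_entropy (mat_mean X Y) \<le> real n / ln 2"
    unfolding W(2) entropy_spec[OF W(1)] by (intro divide_right_mono) (auto simp: sum_negf)
  then show ?thesis
    using S0[OF psd(1) tr(1)] S0[OF psd(2) tr(2)] by (simp add: QJSD_def mat_mean_def)
qed

lemma quantum_operation_density:
  assumes "quantum_operation n \<Phi>" "X \<in> density_mats n"
  shows "\<Phi> X \<in> density_mats n"
  using assms quantum_operation_psd[OF assms(1)]
  by (auto simp: density_mats_def quantum_operation_def trace_preserving_def psd_carrier)

theorem proposition1:
  fixes N K :: nat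
    and \<E> \<F> :: "complex mat \<Rightarrow> complex mat"
    and \<rho> \<sigma> :: "complex mat"
  assumes "N \<ge> 1" and "K \<ge> 1"
    and "quantum_operation N \<E>" and "quantum_operation N \<F>"
    and "\<rho> \<in> density_mats (N * K)" and "\<sigma> \<in> density_mats (N * K)"
  shows "transmission_dist (tensor_id N K \<E> \<rho>) (tensor_id N K \<F> \<sigma>)
           \<le> transmission_dist \<rho> \<sigma> + channel_divergence N K \<E> \<F>"
proof -
  let ?n = "N * K" and ?E = "tensor_id N K \<E>" and ?F = "tensor_id N K \<F>"
  have E: "quantum_operation ?n ?E" and F: "quantum_operation ?n ?F"
    using assms by (auto intro: quantum_operation_tensor_id)
  note dE = quantum_operation_density[OF E] and dF = quantum_operation_density[OF F]
  have psd: "X \<in> density_mats ?n \<Longrightarrow> psd_mat ?n X" for X by (simp add: density_mats_def)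
  \<comment> \<open>The intermediate state is the image of \<open>\<sigma>\<close> under the first
    channel: one leg contracts by monotonicity, the other occurs under the supremum.\<close>
  have "transmission_dist (?E \<rho>) (?F \<sigma>) \<le> transmission_dist (?E \<rho>) (?E \<sigma>) + transmission_dist (?E \<sigma>) (?F \<sigma>)"
    using assms(5,6) by (intro transmission_dist_triangle[of ?n] psd dE dF)
  also have "transmission_dist (?E \<rho>) (?E \<sigma>) \<le> transmission_dist \<rho> \<sigma>"
    unfolding transmission_dist_def using assms(5,6)
    by (intro real_sqrt_le_mono QJSD_quantum_operation_le[OF E] psd)
  also have "transmission_dist (?E \<sigma>) (?F \<sigma>) \<le> channel_divergence N K \<E> \<F>"
    unfolding channel_divergence_def
  proof (rule cSUP_upper[OF assms(6)])
    \<comment> \<open>A real supremum dominates its members only if the set is bounded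
      above.\<close>
    show "bdd_above ((\<lambda>\<sigma>. transmission_dist (?E \<sigma>) (?F \<sigma>)) ` density_mats ?n)"
    proof (rule bdd_aboveI2)
      fix X assume "X \<in> density_mats ?n"
      then show "transmission_dist (?E X) (?F X) \<le> sqrt (real ?n / ln 2)"
        unfolding transmission_dist_def by (intro real_sqrt_le_mono QJSD_density_le dE dF)
    qed
  qed
  finally show ?thesis by simp
qed

end
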